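(* Let $\ell_1,\ell_2>0$ with $\ell_1\neq\ell_2$. Then all three planar projections of a tricycling geodesic, i.e. the trajectories in $\mathbb{R}^2$ of the points $x$, $y_1$ and $y_2$, are 2-solitons.
   Context: 2-linkage: a triple of points $x,m_1,m_2\in\mathbb{R}^2$ with $|xm_1|=\ell_1$, $|xm_2|=\ell_2$ fixed. Coordinates: $x=(x_1,x_2)$ and the directions $\alpha_1,\alpha_2\in\mathbb{R}/2\pi\mathbb{Z}$ of the oriented segments $m_1x$, $m_2x$, so $m_i=x-\ell_i(\cos\alpha_i,\sin\alpha_i)$; for $\ell_1\neq\ell_2$ the configuration space is ${\mathcal C}=\mathbb{R}^2\times T^2$. The segments $xm_1$, $xm_2$ are extended to $xy_1$, $xy_2$ by doubling their lengths: $y_i=x+2(m_i-x)$. A curve in ${\mathcal C}$ is horizontal if the velocity of $m_i$ is parallel to the segment $xm_i$ for $i=1,2$. The length of a horizontal curve is the length of the trajectory of $x$ (which equals the lengths of the trajectories of $y_1$ and $y_2$). A tricycling geodesic is a horizontal curve in ${\mathcal C}$, parameterized by arc length, that locally minimizes length among horizontal curves with the same endpoints. By sub-Riemannian theory, the non-singular geodesics are the projections to ${\mathcal C}$ of the trajectories on the level $H=\frac12$ of the Hamiltonian system on $T^*{\mathcal C}$ with coordinates $(x_1,x_2,\alpha_1,\alpha_2,p_1,p_2,\eta_1,\eta_2)$ (standard symplectic form) and $H=\frac12(L_1^2+L_2^2)$, $L_1=p_1-\frac{\eta_1\sin\alpha_1}{\ell_1}-\frac{\eta_2\sin\alpha_2}{\ell_2}$,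 $L_2=p_2+\frac{\eta_1\cos\alpha_1}{\ell_1}+\frac{\eta_2\cos\alpha_2}{\ell_2}$. A 2-soliton is a planar curve whose curvature $\kappa$, as a function of arc length, satisfies $aE_0+bE_2+E_4=0$ for some constants $a,b$, where $E_0=\kappa$, $E_2=\kappa''+\frac{\kappa^3}{2}$, $E_4=\kappa''''+\frac52\kappa^2\kappa''+\frac52\kappa(\kappa')^2+\frac38\kappa^5$. *)

theory Defs
  imports "HOL-Analysis.Analysis"
begin

text \<open>
  The plane is \<^typ>\<open>complex\<close>.  A 2-linkage is a triple \<open>(x, m\<^sub>1, m\<^sub>2)\<close>; the directions
  \<open>\<alpha>\<^sub>i\<close> modulo \<open>2 \<pi>\<close> are determined by \<open>m\<^sub>i = x - l\<^sub>i cis \<alpha>\<^sub>i\<close>, so that the set of linkages below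
  is a copy of the product of the plane and the torus, without a choice of lifts of the angles.
  All derivatives along a curve are taken within its parameter interval (one-sided at endpoints).
\<close>

type_synonym linkage = "complex \<times> complex \<times> complex"

definition linkages :: "real \<Rightarrow> real \<Rightarrow> linkage set" where
  "linkages l1 l2 = {(x, m1, m2). dist x m1 = l1 \<and> dist x m2 = l2}"

definition pt_x :: "linkage \<Rightarrow> complex" where
  "pt_x = (\<lambda>(x, m1, m2). x)"

definition pt_y1 :: "linkage \<Rightarrow> complex" where
  "pt_y1 = (\<lambda>(x, m1, m2). x + 2 * (m1 - x))"

definition pt_y2 :: "linkage \<Rightarrow> complex" where
  "pt_y2 = (\<lambda>(x, m1, m2). x + 2 * (m2 - x))"

text \<open>Horizontal curves are continuously differentiable; they need not be regular.\<close>

definition horizontal_curve :: "real \<Rightarrow> real \<Rightarrow> real set \<Rightarrow> (real \<Rightarrow> linkage) \<Rightarrow> bool" where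
  "horizontal_curve l1 l2 I \<gamma> \<longleftrightarrow>
     \<gamma> ` I \<subseteq> linkages l1 l2 \<and>
     (\<exists>\<gamma>'. continuous_on I \<gamma>' \<and>
        (\<forall>t\<in>I. (\<gamma> has_vector_derivative \<gamma>' t) (at t within I) \<and>
           (case (\<gamma> t, \<gamma>' t) of ((x, m1, m2), (x', m1', m2')) \<Rightarrow>
              (\<exists>k::real. m1' = k *\<^sub>R (m1 - x)) \<and>
              (\<exists>k::real. m2' = k *\<^sub>R (m2 - x)))))"

definition horizontal_length :: "real \<Rightarrow> real \<Rightarrow> (real \<Rightarrow> linkage) \<Rightarrow> real" where
  "horizontal_length a b \<gamma> =
     integral {a..b} (\<lambda>t. norm (vector_derivative (pt_x \<circ> \<gamma>) (at t within {a..b})))"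

definition length_minimizing :: "real \<Rightarrow> real \<Rightarrow> real \<Rightarrow> real \<Rightarrow> (real \<Rightarrow> linkage) \<Rightarrow> bool" where
  "length_minimizing l1 l2 a b \<gamma> \<longleftrightarrow>
     (\<forall>c d \<delta>. c < d \<longrightarrow> horizontal_curve l1 l2 {c..d} \<delta> \<longrightarrow> \<delta> c = \<gamma> a \<longrightarrow> \<delta> d = \<gamma> b \<longrightarrow>
        horizontal_length a b \<gamma> \<le> horizontal_length c d \<delta>)"

text \<open>Locally minimizing: every sufficiently short arc is minimizing.\<close>

definition tricycling_geodesic :: "real \<Rightarrow> real \<Rightarrow> real set \<Rightarrow> (real \<Rightarrow> linkage) \<Rightarrow> bool" where
  "tricycling_geodesic l1 l2 I \<gamma> \<longleftrightarrow>
     is_interval I \<and> (\<exists>s\<in>I. \<exists>t\<in>I. s < t) \<and>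
     horizontal_curve l1 l2 I \<gamma> \<and>
     (\<forall>t\<in>I. norm (vector_derivative (pt_x \<circ> \<gamma>) (at t within I)) = 1) \<and>
     (\<forall>t\<in>I. \<exists>\<epsilon>>0. \<forall>a\<in>I. \<forall>b\<in>I. t - \<epsilon> < a \<longrightarrow> a < b \<longrightarrow> b < t + \<epsilon> \<longrightarrow>
        length_minimizing l1 l2 a b \<gamma>)"

text \<open>
  \<open>\<kappa>\<close> is the signed curvature of the arc length parametrized plane curve \<open>c\<close>, by the Frenet
  equation \<open>T' = \<kappa> N\<close> with \<open>N = \<i> T\<close>.
\<close>

definition arclength_curvature :: "real set \<Rightarrow> (real \<Rightarrow> complex) \<Rightarrow> (real \<Rightarrow> real) \<Rightarrow> bool" where
  "arclength_curvature I c \<kappa> \<longleftrightarrow>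
     (\<exists>T. \<forall>s\<in>I. (c has_vector_derivative T s) (at s within I) \<and> norm (T s) = 1 \<and>
        (T has_vector_derivative \<kappa> s *\<^sub>R (\<i> * T s)) (at s within I))"

text \<open>The arguments \<open>ki\<close> stand for the \<open>i\<close>-th derivative of the curvature.\<close>

definition E0 :: "real \<Rightarrow> real" where
  "E0 k = k"

definition E2 :: "real \<Rightarrow> real \<Rightarrow> real" where
  "E2 k k2 = k2 + k ^ 3 / 2"

definition E4 :: "real \<Rightarrow> real \<Rightarrow> real \<Rightarrow> real \<Rightarrow> real" where
  "E4 k k1 k2 k4 = k4 + 5 / 2 * k\<^sup>2 * k2 + 5 / 2 * k * k1\<^sup>2 + 3 / 8 * k ^ 5"

definition two_soliton :: "real set \<Rightarrow> (real \<Rightarrow> complex) \<Rightarrow> bool" where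
  "two_soliton I c \<longleftrightarrow>
     (\<exists>\<kappa> \<kappa>1 \<kappa>2 \<kappa>3 \<kappa>4. arclength_curvature I c \<kappa> \<and>
        (\<forall>s\<in>I. (\<kappa> has_real_derivative \<kappa>1 s) (at s within I) \<and>
               (\<kappa>1 has_real_derivative \<kappa>2 s) (at s within I) \<and>
               (\<kappa>2 has_real_derivative \<kappa>3 s) (at s within I) \<and>
               (\<kappa>3 has_real_derivative \<kappa>4 s) (at s within I)) \<and>
        (\<exists>a b :: real. \<forall>s\<in>I.
           a * E0 (\<kappa> s) + b * E2 (\<kappa> s) (\<kappa>2 s) + E4 (\<kappa> s) (\<kappa>1 s) (\<kappa>2 s) (\<kappa>4 s) = 0))"

end

theory Submission
  imports Defs
begin

text \<open>
  Let \<open>u\<close> be the unit velocity of \<open>x\<close>, let \<open>q\<^sub>i\<close> be the unit vector from \<open>m\<^sub>i\<close> to \<open>x\<close>, and put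
  \<open>c\<^sub>i + \<i> s\<^sub>i = u cnj q\<^sub>i / l\<^sub>i\<close>.  A curve is horizontal iff \<open>q\<^sub>i' = s\<^sub>i \<i> q\<^sub>i\<close>, so \<open>s\<^sub>i\<close> is the rate of
  turning of the \<open>i\<close>-th segment.  Choose \<open>g\<^sub>i > 0\<close> with \<open>g\<^sub>i' = c\<^sub>i g\<^sub>i\<close> and let \<open>V\<^sub>i = g\<^sub>i \<i> q\<^sub>i / l\<^sub>i\<close>.
  A computation gives \<open>V\<^sub>i' = (g\<^sub>i / l\<^sub>i\<^sup>2) \<i> u\<close>.

  \<^bold>\<open>The multiplier rule.\<close>  Take a short minimizing arc over \<open>[a, b]\<close> and regard the velocity of \<open>x\<close>
  as a control, an element of the Banach space of continuous functions.  When the control \<open>u\<close> is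
  perturbed by \<open>w\<close>, the end point of \<open>x\<close> changes to first order by \<open>\<integral> w\<close>, the length by
  \<open>\<integral> w \<bullet> u\<close>, and the final direction of the \<open>i\<close>-th segment by \<open>\<integral> w \<bullet> V\<^sub>i\<close> divided by \<open>g\<^sub>i b\<close>.
  If these linear functionals were independent, the map from controls to end points and lengths
  would be open at \<open>u\<close>, and a shorter horizontal curve with the same end points would exist.  Hence
  \<open>n\<^sub>0 u + p + n\<^sub>1 V\<^sub>1 + n\<^sub>2 V\<^sub>2 = 0\<close> on \<open>[a, b]\<close> with constants that do not all vanish
  (\<open>minimizing_imp_multiplier\<close>).  This replaces the Hamiltonian equations and also covers the singular
  geodesics, because \<open>n\<^sub>0 = 0\<close> may occur.

  \<^bold>\<open>From arcs to the whole curve.\<close>  If \<open>n\<^sub>0 \<noteq> 0\<close>, differentiating the relation gives \<open>u' = \<kappa> \<i> u\<close> with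
  \<open>\<kappa> = e\<^sub>1 + e\<^sub>2\<close>, where \<open>e\<^sub>i\<close> is a constant multiple of \<open>g\<^sub>i\<close> (normal arcs).  If \<open>n\<^sub>0 = 0\<close>, it gives
  \<open>c\<^sub>1 = c\<^sub>2\<close> (abnormal arcs).  On a normal arc, \<open>c\<^sub>1 - c\<^sub>2\<close> and \<open>\<kappa> - s\<^sub>1 - s\<^sub>2\<close> solve a homogeneous linear
  system, so a normal arc with an abnormal piece is abnormal.  By connectedness the curve is
  either abnormal throughout, or it has no abnormal piece; in the latter case multipliers on
  overlapping arcs agree, and the whole curve is normal with one pair of constants
  (\<open>abnormal_or_normal\<close>).

  \<^bold>\<open>The soliton equation.\<close>  In the normal case \<open>s\<^sub>i' = (\<kappa> - s\<^sub>i) c\<^sub>i\<close>, \<open>c\<^sub>i' = -(\<kappa> - s\<^sub>i) s\<^sub>i\<close> and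
  \<open>e\<^sub>i' = c\<^sub>i e\<^sub>i\<close>, a closed polynomial system in which all derivatives of \<open>\<kappa>\<close> are polynomials.  With
  \<open>a\<^sub>i = 1 / l\<^sub>i\<^sup>2\<close>, \<open>M\<^sub>n = \<Sum> a\<^sub>i\<^sup>n e\<^sub>i\<close> and \<open>S\<^sub>n = \<Sum> a\<^sub>i\<^sup>n e\<^sub>i s\<^sub>i\<close> one has \<open>M\<^sub>n'' = M\<^sub>n\<^sub>+\<^sub>1 - \<kappa> S\<^sub>n\<close> and
  \<open>S\<^sub>n' = \<kappa> M\<^sub>n'\<close>.  Starting from \<open>\<kappa> = M\<^sub>0\<close>, the expressions \<open>S\<^sub>0\<close> and \<open>S\<^sub>1\<close> can be integrated, which gives two
  constants of motion, and the recurrence \<open>M\<^sub>2 = (a\<^sub>1 + a\<^sub>2) M\<^sub>1 - a\<^sub>1 a\<^sub>2 M\<^sub>0\<close>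
  closes the chain in a fourth order equation, which is the soliton equation.  In the abnormal
  case \<open>\<kappa> = s\<^sub>1 + s\<^sub>2\<close> is the curvature of an elastica, hence again a solution.

  \<^bold>\<open>The curves \<open>y\<^sub>i\<close>.\<close>  The velocity of \<open>y\<^sub>i\<close> is \<open>q\<^sub>i\<^sup>2 cnj u\<close>, so \<open>y\<^sub>i\<close> is parametrized by arc length and has
  curvature \<open>2 s\<^sub>i - \<kappa>\<close>.  This function solves the same equation with the same constants \<open>a\<close>, \<open>b\<close>,
  again by a polynomial identity.
\<close>

section \<open>Intervals\<close>

text \<open>
  The parameter interval of a geodesic may be open, closed or half-open.  Local statements on it are
  reduced to compact intervals, chosen as neighbourhoods of a point relative to \<open>I\<close>, so that
  derivatives within \<open>I\<close> and within the compact interval are the same.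
\<close>

lemma interval_neighbourhood:
  fixes I :: "real set"
  assumes I: "is_interval I" and st: "s \<in> I" "t \<in> I" "s < t" and t0: "t0 \<in> I" and eps: "\<epsilon> > 0"
  obtains a b e where "a < b" "{a..b} \<subseteq> I" "{a..b} \<subseteq> {t0 - \<epsilon><..<t0 + \<epsilon>}"
    "t0 \<in> {a..b}" "e > 0" "I \<inter> {t0 - e<..<t0 + e} \<subseteq> {a..b}"
proof -
  have up: "\<exists>b e. t0 \<le> b \<and> b \<in> I \<and> b < t0 + \<epsilon> \<and> e > 0 \<and> I \<inter> {t0..<t0 + e} \<subseteq> {t0..b} \<and> (b = t0 \<longrightarrow> (\<forall>r\<in>I. r \<le> t0))"
  proof (cases "\<exists>r\<in>I. r > t0")
    case True
    then obtain r where r: "r \<in> I" "r > t0" by blast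
    let ?b = "min r (t0 + \<epsilon>/2)"
    have "?b \<in> I" by (rule mem_is_interval_1_I[OF I t0 r(1)]) (use r eps in auto)
    then show ?thesis using r eps by (intro exI[of _ ?b] exI[of _ "?b - t0"]) auto
  next
    case False
    then show ?thesis using t0 eps by (intro exI[of _ t0] exI[of _ 1]) force
  qed
  have dn: "\<exists>a e. a \<le> t0 \<and> a \<in> I \<and> t0 - \<epsilon> < a \<and> e > 0 \<and> I \<inter> {t0 - e<..t0} \<subseteq> {a..t0} \<and> (a = t0 \<longrightarrow> (\<forall>r\<in>I. r \<ge> t0))"
  proof (cases "\<exists>r\<in>I. r < t0")
    case True
    then obtain r where r: "r \<in> I" "r < t0" by blast
    let ?b = "max r (t0 - \<epsilon>/2)"
    have "?b \<in> I" by (rule mem_is_interval_1_I[OF I r(1) t0]) (use r eps in auto)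
    then show ?thesis using r eps by (intro exI[of _ ?b] exI[of _ "t0 - ?b"]) auto
  next
    case False
    then show ?thesis using t0 eps by (intro exI[of _ t0] exI[of _ 1]) force
  qed
  obtain b e1 where b: "t0 \<le> b" "b \<in> I" "b < t0 + \<epsilon>" "e1 > 0" "I \<inter> {t0..<t0 + e1} \<subseteq> {t0..b}" "b = t0 \<longrightarrow> (\<forall>r\<in>I. r \<le> t0)"
    using up by blast
  obtain a e2 where a: "a \<le> t0" "a \<in> I" "t0 - \<epsilon> < a" "e2 > 0" "I \<inter> {t0 - e2<..t0} \<subseteq> {a..t0}" "a = t0 \<longrightarrow> (\<forall>r\<in>I. r \<ge> t0)"
    using dn by blast
  have "a < b"
  proof (rule ccontr)
    assume "\<not> a < b"
    then have "a = t0" "b = t0" using a(1) b(1) by auto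
    then show False using a(6) b(6) st by force
  qed
  moreover have "{a..b} \<subseteq> I"
    using mem_is_interval_1_I[OF I a(2) b(2)] by auto
  moreover have near: "I \<inter> {t0 - min e1 e2<..<t0 + min e1 e2} \<subseteq> {a..b}"
  proof
    fix r assume r: "r \<in> I \<inter> {t0 - min e1 e2<..<t0 + min e1 e2}"
    show "r \<in> {a..b}"
    proof (cases "r \<ge> t0")
      case True
      then have "r \<in> I \<inter> {t0..<t0 + e1}" using r by auto
      then show ?thesis using b(5) a(1) by auto
    next
      case False
      then have "r \<in> I \<inter> {t0 - e2<..t0}" using r by auto
      then show ?thesis using a(5) b(1) by force
    qed
  qed
  moreover have "{a..b} \<subseteq> {t0 - \<epsilon><..<t0 + \<epsilon>}" using a(3) b(3) by auto
  moreover have "t0 \<in> {a..b}" "min e1 e2 > 0" using a(1,4) b(1,4) by auto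
  ultimately show thesis using near by (intro that)
qed

lemma at_within_interval_neighbourhood:
  fixes I :: "real set"
  assumes "{a..b} \<subseteq> I" "e > 0" "I \<inter> {t - e<..<t + e} \<subseteq> {a..b}"
  shows "at t within I = at t within {a..b}"
  by (rule at_within_nhd[of t "{t - e<..<t + e}"]) (use assms in auto)

lemma antiderivative_on_interval:
  fixes f :: "real \<Rightarrow> real"
  assumes I: "is_interval I" and st: "s \<in> I" "t \<in> I" "s < t" and f: "continuous_on I f"
  obtains F where "\<And>r. r \<in> I \<Longrightarrow> (F has_real_derivative f r) (at r within I)"
proof
  fix r assume r: "r \<in> I"
  obtain a b e where ab: "a < b" "{a..b} \<subseteq> I" "r \<in> {a..b}" "e > 0" "I \<inter> {r - e<..<r + e} \<subseteq> {a..b}"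
    by (rule interval_neighbourhood[OF I st r, of 1]) auto
  let ?a = "min s a" and ?b = "max s b"
  have sub: "{?a..?b} \<subseteq> I"
  proof -
    have "a \<in> I" "b \<in> I" using ab by auto
    then have "?a \<in> I" "?b \<in> I" using st(1) by (simp_all add: min_def max_def)
    from mem_is_interval_1_I[OF I this] show ?thesis by auto
  qed
  have "((\<lambda>u. LBINT y=s..u. f y) has_vector_derivative f r) (at r within {?a..?b})"
    by (rule interval_integral_FTC2) (use ab continuous_on_subset[OF f sub] in auto)
  moreover have "at r within I = at r within {?a..?b}"
    by (rule at_within_interval_neighbourhood[OF sub ab(4) order_trans[OF ab(5)]]) auto
  ultimately show "((\<lambda>u. LBINT y=s..u. f y) has_real_derivative f r) (at r within I)"
    by (simp add: has_real_derivative_iff_has_vector_derivative)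
qed

section \<open>The direction of a segment as a function of the control\<close>

text \<open>
  If \<open>x\<close> moves with velocity \<open>v\<close> and the segment has direction \<open>\<phi>\<close>, then the back end \<open>x - l cis \<phi>\<close>
  moves along the segment iff \<open>\<phi>\<close> has this derivative.
\<close>

definition steering :: "real \<Rightarrow> (real \<Rightarrow> complex) \<Rightarrow> (real \<Rightarrow> real) \<Rightarrow> real \<Rightarrow> real" where
  "steering l v \<phi> t = Im (v t * cis (- \<phi> t)) / l"

definition steered :: "real \<Rightarrow> real \<Rightarrow> real \<Rightarrow> (real \<Rightarrow> complex) \<Rightarrow> (real \<Rightarrow> real) \<Rightarrow> bool" where
  "steered l a b v \<phi> \<longleftrightarrow>
     (\<forall>t\<in>{a..b}. (\<phi> has_real_derivative steering l v \<phi> t) (at t within {a..b}))"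

lemma norm_cis_diff_le: "norm (cis x - cis y) \<le> \<bar>x - y\<bar>"
proof -
  have "norm (cis x - cis y) = norm (cis y * (cis (x - y) - 1))"
    by (simp add: cis_mult ring_distribs)
  also have "\<dots> = norm (cis (x - y) - 1)" by (simp add: norm_mult)
  also have "\<dots> \<le> \<bar>x - y\<bar>"
    using Taylor_exp[of "\<i> * of_real (x - y)" 0]
    by (simp add: cis_conv_exp norm_mult flip: of_real_diff)
  finally show ?thesis .
qed


lemma norm_cis_taylor: "norm (cis x - 1 - \<i> * of_real x) \<le> x\<^sup>2"
  using Taylor_exp[of "\<i> * of_real x" 1]
  by (simp add: cis_conv_exp norm_mult algebra_simps power2_eq_square)

lemma steering_diff_le:
  assumes "l > 0"
  shows "\<bar>steering l v \<phi> t - steering l w \<psi> t\<bar>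
    \<le> (norm (v t - w t) + norm (w t) * \<bar>\<phi> t - \<psi> t\<bar>) / l"
proof -
  have eq: "steering l v \<phi> t - steering l w \<psi> t =
      Im ((v t - w t) * cis (- \<phi> t) + w t * (cis (- \<phi> t) - cis (- \<psi> t))) / l"
    by (simp add: steering_def algebra_simps diff_divide_distrib add_divide_distrib)
  have "norm ((v t - w t) * cis (- \<phi> t) + w t * (cis (- \<phi> t) - cis (- \<psi> t)))
     \<le> norm (v t - w t) + norm (w t) * \<bar>\<phi> t - \<psi> t\<bar>"
    using mult_left_mono[OF norm_cis_diff_le[of "- \<phi> t" "- \<psi> t"], of "norm (w t)"]
    by (intro norm_triangle_le) (simp add: norm_mult abs_minus_commute)
  then have "\<bar>Im ((v t - w t) * cis (- \<phi> t) + w t * (cis (- \<phi> t) - cis (- \<psi> t)))\<bar>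
     \<le> norm (v t - w t) + norm (w t) * \<bar>\<phi> t - \<psi> t\<bar>"
    by (rule order_trans[OF abs_Im_le_cmod])
  then show ?thesis
    using assms unfolding eq abs_divide by (simp add: divide_right_mono)
qed

lemma continuous_on_steering:
  "continuous_on S v \<Longrightarrow> continuous_on S \<phi> \<Longrightarrow> continuous_on S (steering l v \<phi>)"
  unfolding steering_def divide_inverse
  by (intro continuous_intros continuous_on_cis)

lemma steered_continuous_on: "steered l a b v \<phi> \<Longrightarrow> continuous_on {a..b} \<phi>"
  unfolding steered_def by (rule DERIV_continuous_on) auto

text \<open>
  The steering equation is Lipschitz in the angle with constant \<open>norm (v t) / l\<close>.  The bounds \<open>2\<close> and
  \<open>l / 4\<close> make the Picard operator a contraction with factor \<open>1/2\<close> on the whole interval, so that one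
  application of Banach's theorem suffices.
\<close>

lemma steered_exists:
  assumes l: "l > 0" and ab: "a < b" "b - a \<le> l / 4"
    and v: "continuous_on {a..b} v" "\<And>t. t \<in> {a..b} \<Longrightarrow> norm (v t) \<le> 2"
  obtains \<phi> where "steered l a b v \<phi>" "\<phi> a = \<alpha>"
proof -
  define h where "h \<phi> t = \<alpha> + integral {a..t} (steering l v \<phi>)" for \<phi> t
  have conth: "continuous_on (cbox a b) (h \<phi>)" if "continuous_on {a..b} \<phi>" for \<phi>
    unfolding h_def
    using indefinite_integral_continuous_1[OF integrable_continuous_real[OF continuous_on_steering[OF v(1) that]]]
    by (auto intro!: continuous_intros)
  have "\<exists>G. \<forall>x. apply_bcontfun G x = h (apply_bcontfun \<phi>) (clamp a b x)"
    for \<phi> :: "real \<Rightarrow>\<^sub>C real"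
    by (rule continuous_on_cbox_bcontfunE[OF conth[of \<phi>]]) auto
  then obtain G where G: "\<And>(\<phi> :: real \<Rightarrow>\<^sub>C real) x. apply_bcontfun (G \<phi>) x = h (apply_bcontfun \<phi>) (clamp a b x)"
    by metis
  have "dist (G \<phi>) (G \<psi>) \<le> 1/2 * dist \<phi> \<psi>" for \<phi> \<psi> :: "real \<Rightarrow>\<^sub>C real"
  proof (rule dist_bound)
    fix x
    let ?y = "clamp a b x"
    have y: "a \<le> ?y" "?y \<le> b" using clamp_in_interval[of a b x] ab(1) by auto
    have c: "continuous_on {a..?y} (steering l v \<xi>)" if "continuous_on UNIV \<xi>" for \<xi>
      using continuous_on_steering[OF v(1), of \<xi> l] that y
      by (meson continuous_on_subset atLeastatMost_subset_iff order_refl top_greatest)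
    have i: "steering l v \<xi> integrable_on {a..?y}" if "continuous_on UNIV \<xi>" for \<xi>
      using c[OF that] by (rule integrable_continuous_real)
    have "dist (apply_bcontfun (G \<phi>) x) (apply_bcontfun (G \<psi>) x)
      = norm (integral {a..?y} (\<lambda>t. steering l v \<phi> t - steering l v \<psi> t))"
      unfolding G h_def by (subst integral_diff) (auto simp: dist_real_def intro!: i)
    also have "\<dots> \<le> 2 / l * dist \<phi> \<psi> * (?y - a)"
    proof (rule integral_bound[OF y(1)])
      show "continuous_on {a..?y} (\<lambda>t. steering l v \<phi> t - steering l v \<psi> t)"
        by (intro continuous_intros c) auto
      fix t assume t: "t \<in> {a..?y}"
      have "\<bar>steering l v \<phi> t - steering l v \<psi> t\<bar> \<le> (0 + norm (v t) * \<bar>\<phi> t - \<psi> t\<bar>) / l"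
        using steering_diff_le[OF l, of v \<phi> t v \<psi>] by simp
      also have "\<dots> \<le> (0 + 2 * dist \<phi> \<psi>) / l"
        using v(2)[of t] t y l dist_bounded[of \<phi> t \<psi>]
        by (intro divide_right_mono add_mono mult_mono) (auto simp: dist_real_def)
      finally show "norm (steering l v \<phi> t - steering l v \<psi> t) \<le> 2 / l * dist \<phi> \<psi>" by simp
    qed
    also have "\<dots> \<le> 2 / l * dist \<phi> \<psi> * (l / 4)"
      using y ab l by (intro mult_left_mono) auto
    finally show "dist (apply_bcontfun (G \<phi>) x) (apply_bcontfun (G \<psi>) x) \<le> 1/2 * dist \<phi> \<psi>"
      using l by simp
  qed
  then obtain \<phi> where \<phi>: "G \<phi> = \<phi>" using banach_fix_type[of "1/2" G] by auto
  have fixed: "\<phi> t = h \<phi> t" if "t \<in> {a..b}" for t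
    using G[of \<phi> t] that unfolding \<phi> by simp
  show thesis
  proof
    show "steered l a b v \<phi>"
      unfolding steered_def
    proof
      fix t assume t: "t \<in> {a..b}"
      have "(h \<phi> has_real_derivative steering l v \<phi> t) (at t within {a..b})"
        unfolding h_def
        using integral_has_real_derivative[OF continuous_on_steering[OF v(1)], of \<phi> t l] t
        by (auto intro!: derivative_eq_intros)
      then show "(\<phi> has_real_derivative steering l v \<phi> t) (at t within {a..b})"
        by (rule has_field_derivative_transform_within[of _ _ _ _ 1]) (use t fixed in auto)
    qed
    show "\<phi> a = \<alpha>" using fixed[of a] ab by (simp add: h_def)
  qed
qed

text \<open>
  Lipschitz dependence on the control.  On so short an interval no exponential factor is needed: the
  maximal difference \<open>M\<close> satisfies \<open>M \<le> (\<epsilon> + 2 M) / 4\<close>.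
\<close>

lemma steered_diff_le:
  assumes l: "l > 0" and ab: "a \<le> b" "b - a \<le> l / 4"
    and \<phi>: "steered l a b v \<phi>" and \<psi>: "steered l a b w \<psi>" and init: "\<phi> a = \<psi> a"
    and w: "\<And>t. t \<in> {a..b} \<Longrightarrow> norm (w t) \<le> 2"
    and vw: "\<And>t. t \<in> {a..b} \<Longrightarrow> norm (v t - w t) \<le> \<epsilon>"
    and t: "t \<in> {a..b}"
  shows "\<bar>\<phi> t - \<psi> t\<bar> \<le> \<epsilon>"
proof -
  have "continuous_on {a..b} (\<lambda>t. \<bar>\<phi> t - \<psi> t\<bar>)"
    by (intro continuous_intros steered_continuous_on[OF \<phi>] steered_continuous_on[OF \<psi>])
  then obtain r where r: "r \<in> {a..b}" "\<And>t. t \<in> {a..b} \<Longrightarrow> \<bar>\<phi> t - \<psi> t\<bar> \<le> \<bar>\<phi> r - \<psi> r\<bar>"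
    using continuous_attains_sup[of "{a..b}"] ab by force
  let ?M = "\<bar>\<phi> r - \<psi> r\<bar>"
  have "0 \<le> norm (v a - w a)" by simp
  also have "\<dots> \<le> \<epsilon>" using vw[of a] ab by simp
  finally have "\<epsilon> \<ge> 0" .
  have "norm ((\<lambda>t. \<phi> t - \<psi> t) r - (\<lambda>t. \<phi> t - \<psi> t) a) \<le> (\<epsilon> + 2 * ?M) / l * norm (r - a)"
  proof (rule field_differentiable_bound[of "{a..b}"])
    fix t assume t: "t \<in> {a..b}"
    show "((\<lambda>t. \<phi> t - \<psi> t) has_real_derivative steering l v \<phi> t - steering l w \<psi> t) (at t within {a..b})"
      using \<phi> \<psi> t unfolding steered_def by (auto intro!: derivative_intros)
    have "(norm (v t - w t) + norm (w t) * \<bar>\<phi> t - \<psi> t\<bar>) / l \<le> (\<epsilon> + 2 * ?M) / l"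
      using l w[OF t] vw[OF t] r(2)[OF t] by (intro divide_right_mono add_mono mult_mono) auto
    then show "norm (steering l v \<phi> t - steering l w \<psi> t) \<le> (\<epsilon> + 2 * ?M) / l"
      using steering_diff_le[OF l, of v \<phi> t w \<psi>] by simp
  qed (use r ab in auto)
  also have "\<dots> \<le> (\<epsilon> + 2 * ?M) / l * (l / 4)"
    using r(1) ab l \<open>\<epsilon> \<ge> 0\<close> by (intro mult_left_mono) auto
  finally have "?M \<le> (\<epsilon> + 2 * ?M) / 4" using l init by simp
  then show ?thesis using r(2)[OF t] \<open>\<epsilon> \<ge> 0\<close> by simp
qed

text \<open>
  The linearization of the steering equation at \<open>\<phi>\<close> is \<open>D' = - c D + Im (w cis (-\<phi>)) / l\<close> with
  \<open>c = Re (v cis (-\<phi>)) / l\<close>; multiplication by the integrating factor \<open>g\<close> turns the variation \<open>D\<close> of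
  the angle into an integral of the perturbation \<open>w\<close>.  The error is quadratic because the angle
  itself changes by at most \<open>\<epsilon>\<close>.
\<close>

lemma steered_first_variation:
  assumes l: "l > 0" and ab: "a \<le> b" "b - a \<le> l / 4"
    and v: "continuous_on {a..b} v" "\<And>t. t \<in> {a..b} \<Longrightarrow> norm (v t) \<le> 2"
    and w: "continuous_on {a..b} w" "\<And>t. t \<in> {a..b} \<Longrightarrow> norm (w t) \<le> \<epsilon>"
    and \<phi>: "steered l a b v \<phi>" and \<psi>: "steered l a b (\<lambda>t. v t + w t) \<psi>" and init: "\<phi> a = \<psi> a"
    and g: "\<And>t. t \<in> {a..b} \<Longrightarrow>
       (g has_real_derivative Re (v t * cis (- \<phi> t)) / l * g t) (at t within {a..b})"
    and B: "\<And>t. t \<in> {a..b} \<Longrightarrow> \<bar>g t\<bar> \<le> B"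
  shows "\<bar>g b * (\<psi> b - \<phi> b) - integral {a..b} (\<lambda>t. g t * Im (w t * cis (- \<phi> t)) / l)\<bar> \<le> B * \<epsilon>\<^sup>2"
proof -
  have D: "\<bar>\<psi> t - \<phi> t\<bar> \<le> \<epsilon>" if "t \<in> {a..b}" for t
    by (rule steered_diff_le[OF l ab \<psi> \<phi> init[symmetric]]) (use v w that in auto)
  have eps: "\<epsilon> \<ge> 0" using D[of a] ab by (auto simp: init)
  have B0: "B \<ge> 0" using B[of a] ab by auto
  have contg: "continuous_on {a..b} g" by (rule DERIV_continuous_on, rule g)
  have cis: "continuous_on {a..b} (\<lambda>t. cis (- \<phi> t))"
    by (intro continuous_on_cis continuous_intros steered_continuous_on[OF \<phi>])
  define f where "f t = g t * Im (w t * cis (- \<phi> t)) / l" for t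
  \<comment> \<open>the part of the derivative of \<open>\<psi> - \<phi>\<close> that is of second order in \<open>w\<close>\<close>
  define \<rho> where "\<rho> t = (Im (w t * (cis (- \<psi> t) - cis (- \<phi> t))) +
      Im (v t * cis (- \<phi> t) * (cis (- (\<psi> t - \<phi> t)) - 1 - \<i> * of_real (- (\<psi> t - \<phi> t))))) / l" for t
  have contf: "continuous_on {a..b} f"
    unfolding f_def divide_inverse by (intro continuous_intros contg w cis)
  define G where "G t = g t * (\<psi> t - \<phi> t) - integral {a..t} f" for t
  have "norm (G b - G a) \<le> B * (3 * \<epsilon>\<^sup>2 / l) * norm (b - a)"
  proof (rule field_differentiable_bound[of "{a..b}"])
    fix t assume t: "t \<in> {a..b}"
    have p: "(\<phi> has_real_derivative steering l v \<phi> t) (at t within {a..b})"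
        "(\<psi> has_real_derivative steering l (\<lambda>t. v t + w t) \<psi> t) (at t within {a..b})"
      using \<phi> \<psi> t unfolding steered_def by auto
    have "(G has_real_derivative Re (v t * cis (- \<phi> t)) / l * g t * (\<psi> t - \<phi> t)
         + g t * (steering l (\<lambda>t. v t + w t) \<psi> t - steering l v \<phi> t) - f t) (at t within {a..b})"
      unfolding G_def
      by (rule derivative_eq_intros g[OF t] p integral_has_real_derivative[OF contf t] refl)+ (simp add: algebra_simps)
    moreover have "Re (v t * cis (- \<phi> t)) / l * g t * (\<psi> t - \<phi> t)
         + g t * (steering l (\<lambda>t. v t + w t) \<psi> t - steering l v \<phi> t) - f t = g t * \<rho> t"
    proof -
      have "cis (- \<phi> t) * cis (- (\<psi> t - \<phi> t)) = cis (- \<psi> t)" by (simp add: cis_mult)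
      then have "v t * cis (- \<phi> t) * (cis (- (\<psi> t - \<phi> t)) - 1 - \<i> * of_real (- (\<psi> t - \<phi> t)))
        = v t * cis (- \<psi> t) - v t * cis (- \<phi> t) + of_real (\<psi> t - \<phi> t) * (\<i> * (v t * cis (- \<phi> t)))"
        by (simp add: algebra_simps)
      then show ?thesis
        unfolding \<rho>_def f_def steering_def using l
        by (simp add: divide_simps del: of_real_diff) (simp add: algebra_simps)
    qed
    ultimately show "(G has_real_derivative g t * \<rho> t) (at t within {a..b})" by simp
    have "norm (cis (- \<psi> t) - cis (- \<phi> t)) \<le> \<epsilon>"
      using norm_cis_diff_le[of "- \<psi> t" "- \<phi> t"] D[OF t] by (simp add: abs_minus_commute)
    then have 1: "\<bar>Im (w t * (cis (- \<psi> t) - cis (- \<phi> t)))\<bar> \<le> \<epsilon> * \<epsilon>"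
      using w(2)[OF t] eps by (intro order_trans[OF abs_Im_le_cmod]) (simp add: norm_mult mult_mono)
    have "norm (cis (- (\<psi> t - \<phi> t)) - 1 - \<i> * of_real (- (\<psi> t - \<phi> t))) \<le> (- (\<psi> t - \<phi> t))\<^sup>2"
      by (rule norm_cis_taylor)
    also have "\<dots> \<le> \<epsilon>\<^sup>2" using D[OF t] eps by (simp add: abs_le_square_iff[symmetric])
    finally have 2: "\<bar>Im (v t * cis (- \<phi> t) * (cis (- (\<psi> t - \<phi> t)) - 1 - \<i> * of_real (- (\<psi> t - \<phi> t))))\<bar> \<le> 2 * \<epsilon>\<^sup>2"
      using v(2)[OF t]
      by (intro order_trans[OF abs_Im_le_cmod]) (simp add: norm_mult mult_mono del: of_real_diff of_real_minus)
    have "\<bar>\<rho> t\<bar> \<le> 3 * \<epsilon>\<^sup>2 / l"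
      unfolding \<rho>_def abs_divide using l 1 2
      by (simp add: divide_right_mono power2_eq_square)
    then show "norm (g t * \<rho> t) \<le> B * (3 * \<epsilon>\<^sup>2 / l)"
      unfolding real_norm_def abs_mult by (intro mult_mono B[OF t] B0) auto
  qed (use ab in auto)
  also have "\<dots> \<le> B * (3 * \<epsilon>\<^sup>2 / l) * (l / 4)"
    using ab l B0 by (intro mult_left_mono) auto
  also have "\<dots> \<le> B * \<epsilon>\<^sup>2"
  proof -
    have "3 * \<epsilon>\<^sup>2 / l * (l / 4) = 3/4 * \<epsilon>\<^sup>2" using l by simp
    also have "\<dots> \<le> \<epsilon>\<^sup>2" by simp
    finally show ?thesis using mult_left_mono[OF _ B0] by (metis mult.assoc)
  qed
  finally show ?thesis using init unfolding G_def f_def[abs_def] by simp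
qed

section \<open>First variation of end points and length\<close>

text \<open>
  The abstract Lagrange multiplier rule.  The derivative is only needed at one point, where its
  surjectivity makes the map open by Sussmann's theorem.
\<close>

lemma open_map_or_multiplier:
  fixes f :: "'a::real_normed_vector \<Rightarrow> 'b::euclidean_space"
  assumes S: "open S" "x \<in> S" and f: "continuous_on S f" "(f has_derivative f') (at x)"
  shows "f x \<in> interior (f ` S) \<or> (\<exists>z. z \<noteq> 0 \<and> (\<forall>w. z \<bullet> f' w = 0))"
proof (cases "surj f'")
  case True
  have "linear f'" using f(2) has_derivative_linear by blast
  then obtain g' where g': "linear g'" "f' \<circ> g' = id"
    using True linear_surjective_right_inverse by blast
  then have "f x \<in> interior (f ` S)"
    using sussmann_open_mapping[OF S(1) f(1) S(2) f(2), of g' S] S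
    by (simp add: linear_conv_bounded_linear interior_open)
  then show ?thesis ..
next
  case False
  have "linear f'" using f(2) has_derivative_linear by blast
  then have "span (range f') = range f'"
    by (simp add: linear_subspace_image span_eq_iff)
  then have "span (range f') \<subset> span UNIV" using False unfolding span_UNIV by blast
  from orthogonal_to_subspace_exists_gen[OF this]
  obtain z where "z \<noteq> 0" "\<And>y. y \<in> span (range f') \<Longrightarrow> orthogonal z y" by blast
  then show ?thesis unfolding orthogonal_def by (blast intro: span_base)
qed

lemma has_derivative_quadratic_remainder:
  assumes "bounded_linear f'"
    and R: "\<And>w. norm w < 1 \<Longrightarrow> norm (f (x + w) - f x - f' w) \<le> C * (norm w)\<^sup>2"
  shows "(f has_derivative f') (at x)"
proof (rule has_derivativeI_sandwich[of 1, OF _ assms(1)])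
  fix y assume y: "y \<noteq> x" "dist y x < 1"
  show "norm (f y - f x - f' (y - x)) / norm (y - x) \<le> C * norm (y - x)"
    using R[of "y - x"] y by (simp add: dist_norm field_simps power2_eq_square)
next
  show "((\<lambda>y. C * norm (y - x)) \<longlongrightarrow> 0) (at x)"
    by (auto intro!: tendsto_eq_intros)
qed simp

lemma bounded_linear_integral_inner:
  fixes V :: "real \<Rightarrow> 'a::euclidean_space"
  assumes "a \<le> b" and V: "continuous_on {a..b} V"
  shows "bounded_linear (\<lambda>w :: real \<Rightarrow>\<^sub>C 'a. integral {a..b} (\<lambda>t. w t \<bullet> V t))"
proof -
  have "bounded (V ` {a..b})" by (intro compact_imp_bounded compact_continuous_image V compact_Icc)
  then obtain B where B: "\<And>t. t \<in> {a..b} \<Longrightarrow> norm (V t) \<le> B" unfolding bounded_iff by blast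
  have c: "continuous_on {a..b} (\<lambda>t. w t \<bullet> V t)" for w :: "real \<Rightarrow>\<^sub>C 'a"
    by (intro continuous_intros V) auto
  have int: "(\<lambda>t. w t \<bullet> V t) integrable_on {a..b}" for w :: "real \<Rightarrow>\<^sub>C 'a"
    by (rule integrable_continuous_real[OF c])
  show ?thesis
  proof (rule bounded_linear_intro[of _ "B * (b - a)"])
    fix w :: "real \<Rightarrow>\<^sub>C 'a"
    have "norm (integral {a..b} (\<lambda>t. w t \<bullet> V t)) \<le> norm w * B * (b - a)"
    proof (rule integral_bound[OF assms(1) c])
      fix t assume t: "t \<in> {a..b}"
      have "norm (w t \<bullet> V t) \<le> norm (w t) * norm (V t)" by (simp add: Cauchy_Schwarz_ineq2)
      also have "\<dots> \<le> norm w * B" using B[OF t] by (intro mult_mono norm_bounded) auto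
      finally show "norm (w t \<bullet> V t) \<le> norm w * B" .
    qed
    then show "norm (integral {a..b} (\<lambda>t. w t \<bullet> V t)) \<le> norm w * (B * (b - a))"
      by (simp add: mult.assoc)
  qed (simp_all add: inner_add_left integral_add int)
qed

lemma bounded_linear_integral_bcontfun:
  assumes "a \<le> b"
  shows "bounded_linear (\<lambda>w :: real \<Rightarrow>\<^sub>C 'a::euclidean_space. integral {a..b} (\<lambda>t. w t))"
proof -
  have int: "apply_bcontfun w integrable_on {a..b}" for w :: "real \<Rightarrow>\<^sub>C 'a"
    by (rule integrable_continuous_real) simp
  show ?thesis
  proof (rule bounded_linear_intro[of _ "b - a"])
    fix w :: "real \<Rightarrow>\<^sub>C 'a"
    show "norm (integral {a..b} (\<lambda>t. w t)) \<le> norm w * (b - a)"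
      by (rule integral_bound[OF assms]) (auto intro: norm_bounded)
  qed (simp_all add: integral_add int)
qed

text \<open>
  For a unit vector \<open>U\<close> the norm of \<open>U + w\<close> lies between \<open>1 + w \<bullet> U\<close> (Cauchy-Schwarz) and
  \<open>1 + w \<bullet> U + (norm w)\<^sup>2\<close> (from \<open>2 r \<le> r\<^sup>2 + 1\<close>), so the remainder is quadratic.
\<close>

lemma length_first_variation:
  fixes U :: "real \<Rightarrow>\<^sub>C 'a::euclidean_space"
  assumes ab: "a \<le> b" and U: "\<And>t. t \<in> {a..b} \<Longrightarrow> norm (U t) = 1"
  shows "((\<lambda>v :: real \<Rightarrow>\<^sub>C 'a. integral {a..b} (\<lambda>t. norm (v t))) has_derivative
    (\<lambda>w :: real \<Rightarrow>\<^sub>C 'a. integral {a..b} (\<lambda>t. w t \<bullet> U t))) (at U)"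
proof (rule has_derivative_quadratic_remainder)
  show "bounded_linear (\<lambda>w :: real \<Rightarrow>\<^sub>C 'a. integral {a..b} (\<lambda>t. w t \<bullet> U t))"
    by (rule bounded_linear_integral_inner[OF ab]) simp
  fix w :: "real \<Rightarrow>\<^sub>C 'a"
  have 1: "(\<lambda>t. norm (v t)) integrable_on {a..b}" for v :: "real \<Rightarrow>\<^sub>C 'a"
    by (intro integrable_continuous_real continuous_intros) auto
  have 2: "(\<lambda>t. w t \<bullet> U t) integrable_on {a..b}"
    by (intro integrable_continuous_real continuous_intros) auto
  have "integral {a..b} (\<lambda>t. norm ((U + w) t)) - integral {a..b} (\<lambda>t. norm (U t)) -
          integral {a..b} (\<lambda>t. w t \<bullet> U t)
     = integral {a..b} (\<lambda>t. norm ((U + w) t) - norm (U t) - w t \<bullet> U t)"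
    by (simp only: integral_diff 1 2 integrable_diff)
  also have "norm \<dots> \<le> (norm w)\<^sup>2 * (b - a)"
  proof (rule integral_bound[OF ab])
    fix t assume t: "t \<in> {a..b}"
    have sq: "(norm (U t + w t))\<^sup>2 = 1 + 2 * (w t \<bullet> U t) + (norm (w t))\<^sup>2"
      using U[OF t] by (simp add: power2_norm_eq_inner inner_add_left inner_add_right inner_commute norm_eq_1)
    have "1 + w t \<bullet> U t = (U t + w t) \<bullet> U t"
      using U[OF t] by (simp add: inner_add_left norm_eq_1)
    also have "\<dots> \<le> norm (U t + w t)" using norm_cauchy_schwarz[of "U t + w t" "U t"] U[OF t] by simp
    finally have lo: "1 + w t \<bullet> U t \<le> norm (U t + w t)" .
    have "2 * norm (U t + w t) \<le> (norm (U t + w t))\<^sup>2 + 1"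
      using sum_squares_ge_zero[of "norm (U t + w t) - 1" 0] by (simp add: algebra_simps power2_eq_square)
    then have hi: "norm (U t + w t) \<le> 1 + w t \<bullet> U t + (norm (w t))\<^sup>2" 
      using zero_le_power2[of "norm (w t)"] unfolding sq by linarith
    have "(norm (w t))\<^sup>2 \<le> (norm w)\<^sup>2" by (intro power_mono norm_bounded) simp
    then show "norm (norm ((U + w) t) - norm (U t) - w t \<bullet> U t) \<le> (norm w)\<^sup>2"
      using lo hi U[OF t] unfolding real_norm_def plus_bcontfun.rep_eq by linarith
  qed (auto intro!: continuous_intros)
  finally show "norm (integral {a..b} (\<lambda>t. norm ((U + w) t)) - integral {a..b} (\<lambda>t. norm (U t)) -
          integral {a..b} (\<lambda>t. w t \<bullet> U t)) \<le> (b - a) * (norm w)\<^sup>2"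
    by (simp only: mult.commute)
qed

lemma continuous_on_length:
  assumes "a \<le> b"
  shows "continuous_on S (\<lambda>v :: real \<Rightarrow>\<^sub>C 'a::euclidean_space. integral {a..b} (\<lambda>t. norm (v t)))"
proof (rule continuous_on_subset[OF _ subset_UNIV], rule lipschitz_on_continuous_on, rule lipschitz_onI)
  fix v w :: "real \<Rightarrow>\<^sub>C 'a"
  have 1: "(\<lambda>t. norm (v t)) integrable_on {a..b}" for v :: "real \<Rightarrow>\<^sub>C 'a"
    by (intro integrable_continuous_real continuous_intros) auto
  have "dist (integral {a..b} (\<lambda>t. norm (v t))) (integral {a..b} (\<lambda>t. norm (w t)))
     = norm (integral {a..b} (\<lambda>t. norm (v t) - norm (w t)))"
    unfolding dist_norm by (simp only: integral_diff 1)
  also have "\<dots> \<le> dist v w * (b - a)"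
  proof (rule integral_bound[OF assms])
    fix t
    have "norm (norm (v t) - norm (w t)) \<le> norm (v t - w t)" by (simp add: norm_triangle_ineq3)
    also have "\<dots> \<le> dist v w" using dist_bounded[of v t w] by (simp add: dist_norm)
    finally show "norm (norm (v t) - norm (w t)) \<le> dist v w" .
  qed (auto intro!: continuous_intros)
  finally show "dist (integral {a..b} (\<lambda>t. norm (v t))) (integral {a..b} (\<lambda>t. norm (w t))) \<le> (b - a) * dist v w"
    by (simp only: mult.commute)
qed (use assms in simp)

lemma endpoint_angle_first_variation:
  fixes U :: "real \<Rightarrow>\<^sub>C complex" and sol :: "(real \<Rightarrow>\<^sub>C complex) \<Rightarrow> real \<Rightarrow> real"
  assumes l: "l > 0" and ab: "a \<le> b" "b - a \<le> l / 4"
    and U: "\<And>t. t \<in> {a..b} \<Longrightarrow> norm (U t) = 1"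
    and sol: "\<And>v. v \<in> ball U 1 \<Longrightarrow> steered l a b v (sol v)" "\<And>v. v \<in> ball U 1 \<Longrightarrow> sol v a = \<alpha>"
    and g: "\<And>t. t \<in> {a..b} \<Longrightarrow>
       (g has_real_derivative Re (U t * cis (- sol U t)) / l * g t) (at t within {a..b})"
  shows "continuous_on (ball U 1) (\<lambda>v. g b * sol v b)"
    and "((\<lambda>v. g b * sol v b) has_derivative
      (\<lambda>w :: real \<Rightarrow>\<^sub>C complex. integral {a..b} (\<lambda>t. w t \<bullet> ((g t / l) *\<^sub>R (\<i> * cis (sol U t)))))) (at U)"
proof -
  have UU: "U \<in> ball U 1" by simp
  have le2: "norm (apply_bcontfun v t) \<le> 2" if "v \<in> ball U 1" "t \<in> {a..b}" for v t
  proof -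
    have "norm (v t) \<le> norm (U t) + norm (v t - U t)" using norm_triangle_sub by blast
    also have "norm (v t - U t) \<le> dist v U" using dist_bounded[of v t U] by (simp add: dist_norm)
    finally show ?thesis using U[OF that(2)] that(1) by (simp add: dist_commute)
  qed
  have b: "b \<in> {a..b}" using ab by simp
  show "continuous_on (ball U 1) (\<lambda>v. g b * sol v b)"
  proof (rule continuous_on_mult_left, rule lipschitz_on_continuous_on, rule lipschitz_onI)
    fix v w :: "real \<Rightarrow>\<^sub>C complex" assume vw: "v \<in> ball U 1" "w \<in> ball U 1"
    have "\<bar>sol v b - sol w b\<bar> \<le> dist v w"
    proof (rule steered_diff_le[OF l ab sol(1)[OF vw(1)] sol(1)[OF vw(2)] _ _ _ b])
      show "norm (v t - w t) \<le> dist v w" for t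
        using dist_bounded[of v t w] by (simp add: dist_norm)
    qed (use vw sol(2) le2 in auto)
    then show "dist (sol v b) (sol w b) \<le> 1 * dist v w" by (simp add: dist_norm)
  qed simp
  have contg: "continuous_on {a..b} g" by (rule DERIV_continuous_on, rule g)
  have cc: "continuous_on {a..b} (sol U)" using steered_continuous_on sol(1)[OF UU] by blast
  have "bounded (g ` {a..b})" by (intro compact_imp_bounded compact_continuous_image contg compact_Icc)
  then obtain B where B: "\<And>t. t \<in> {a..b} \<Longrightarrow> \<bar>g t\<bar> \<le> B" unfolding bounded_iff real_norm_def by blast
  show "((\<lambda>v. g b * sol v b) has_derivative
      (\<lambda>w :: real \<Rightarrow>\<^sub>C complex. integral {a..b} (\<lambda>t. w t \<bullet> ((g t / l) *\<^sub>R (\<i> * cis (sol U t)))))) (at U)"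
  proof (rule has_derivative_quadratic_remainder)
    show "bounded_linear (\<lambda>w :: real \<Rightarrow>\<^sub>C complex. integral {a..b} (\<lambda>t. w t \<bullet> ((g t / l) *\<^sub>R (\<i> * cis (sol U t)))))"
      using l by (intro bounded_linear_integral_inner ab continuous_intros contg cc) auto
    fix w :: "real \<Rightarrow>\<^sub>C complex" assume w: "norm w < 1"
    then have Uw: "U + w \<in> ball U 1" by (simp add: dist_norm)
    have inn: "w t \<bullet> ((g t / l) *\<^sub>R (\<i> * cis (sol U t))) = g t * Im (w t * cis (- sol U t)) / l" for t
      by (simp add: inner_complex_def algebra_simps diff_divide_distrib)
    have "\<bar>g b * (sol (U + w) b - sol U b) - integral {a..b} (\<lambda>t. g t * Im (w t * cis (- sol U t)) / l)\<bar>
      \<le> B * (norm w)\<^sup>2"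
    proof (rule steered_first_variation[OF l ab _ _ _ _ sol(1)[OF UU] _ _ g B])
      show "steered l a b (\<lambda>t. U t + w t) (sol (U + w))" using sol(1)[OF Uw] by (simp add: plus_bcontfun.rep_eq)
      show "sol U a = sol (U + w) a" using sol(2) UU Uw by metis
    qed (use le2[OF UU] in \<open>auto intro: norm_bounded\<close>)
    then show "norm (g b * sol (U + w) b - g b * sol U b -
         integral {a..b} (\<lambda>t. w t \<bullet> ((g t / l) *\<^sub>R (\<i> * cis (sol U t))))) \<le> B * (norm w)\<^sup>2"
      unfolding inn by (simp only: right_diff_distrib real_norm_def)
  qed
qed

section \<open>The multiplier rule for minimizing arcs\<close>

text \<open>
  The horizontality of one segment, expressed by its unit direction \<open>q\<close> and the velocity \<open>u\<close> of its front
  end, without a choice of angle.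
\<close>

definition bicycling :: "real \<Rightarrow> real set \<Rightarrow> (real \<Rightarrow> complex) \<Rightarrow> (real \<Rightarrow> complex) \<Rightarrow> bool" where
  "bicycling l I u q \<longleftrightarrow> (\<forall>t\<in>I. norm (q t) = 1 \<and>
     (q has_vector_derivative (Im (u t * cnj (q t)) / l) *\<^sub>R (\<i> * q t)) (at t within I))"

lemma has_vector_derivative_cis:
  assumes "(\<phi> has_real_derivative d) (at t within S)"
  shows "((\<lambda>t. cis (\<phi> t)) has_vector_derivative d *\<^sub>R (\<i> * cis (\<phi> t))) (at t within S)"
  using has_derivative_cis[OF assms[unfolded has_field_derivative_def]]
  by (simp add: has_vector_derivative_def mult.commute)

lemma steered_imp_bicycling:
  "steered l a b v \<phi> \<Longrightarrow> bicycling l {a..b} v (\<lambda>t. cis (\<phi> t))"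
  unfolding steered_def bicycling_def steering_def
  by (auto simp: cis_cnj intro!: has_vector_derivative_cis)

lemma bicycling_lift:
  assumes ab: "a \<le> b" and u: "continuous_on {a..b} u" and q: "bicycling l {a..b} u q"
  obtains \<phi> where "steered l a b u \<phi>" "\<And>t. t \<in> {a..b} \<Longrightarrow> q t = cis (\<phi> t)"
proof -
  have contq: "continuous_on {a..b} q"
    using q unfolding bicycling_def
    by (intro continuous_on_vector_derivative) blast
  define s where "s t = Im (u t * cnj (q t)) / l" for t
  have conts: "continuous_on {a..b} s"
    unfolding s_def divide_inverse by (intro continuous_intros u contq)
  define \<phi> where "\<phi> t = Arg (q a) + integral {a..t} s" for t
  have \<phi>: "(\<phi> has_real_derivative s t) (at t within {a..b})" if "t \<in> {a..b}" for t
    unfolding \<phi>_def using integral_has_real_derivative[OF conts that]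
    by (auto intro!: derivative_eq_intros)
  have nq: "norm (q t) = 1" if "t \<in> {a..b}" for t using q that unfolding bicycling_def by blast
  have "\<exists>c. \<forall>t\<in>{a..b}. q t * cis (- \<phi> t) = c"
  proof (rule has_vector_derivative_zero_constant)
    fix t assume t: "t \<in> {a..b}"
    have "(q has_vector_derivative s t *\<^sub>R (\<i> * q t)) (at t within {a..b})"
      using q t unfolding bicycling_def s_def by blast
    moreover have "((\<lambda>t. cis (- \<phi> t)) has_vector_derivative (- s t) *\<^sub>R (\<i> * cis (- \<phi> t))) (at t within {a..b})"
      by (rule has_vector_derivative_cis) (rule derivative_intros \<phi>[OF t])+
    ultimately show "((\<lambda>t. q t * cis (- \<phi> t)) has_vector_derivative 0) (at t within {a..b})"
      by (rule has_vector_derivative_eq_rhs[OF has_vector_derivative_mult]) (simp add: scaleR_conv_of_real algebra_simps)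
  qed (simp, blast)
  moreover have "q a * cis (- \<phi> a) = 1"
  proof -
    have "cis (Arg (q a)) = q a"
      using nq[of a] ab cis_Arg[of "q a"] by (force simp: sgn_div_norm)
    then have "q a * cis (- \<phi> a) = cis (\<phi> a) * cis (- \<phi> a)" by (simp add: \<phi>_def)
    then show ?thesis by (simp only: cis_mult) simp
  qed
  ultimately have e: "q t * cis (- \<phi> t) = 1" if "t \<in> {a..b}" for t
    using that ab by (metis atLeastAtMost_iff order_refl)
  have qc: "q t = cis (\<phi> t)" if "t \<in> {a..b}" for t
  proof -
    have "q t = q t * (cis (- \<phi> t) * cis (\<phi> t))" by (simp add: cis_mult)
    also have "\<dots> = cis (\<phi> t)" using e[OF that] by (simp flip: mult.assoc)
    finally show ?thesis .
  qed
  have "steered l a b u \<phi>"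
    unfolding steered_def steering_def using \<phi> by (simp add: s_def qc cis_cnj)
  then show thesis using qc that by blast
qed

definition linkage_at :: "real \<Rightarrow> real \<Rightarrow> complex \<Rightarrow> complex \<Rightarrow> complex \<Rightarrow> linkage" where
  "linkage_at l1 l2 x q1 q2 = (x, x - l1 *\<^sub>R q1, x - l2 *\<^sub>R q2)"

text \<open>
  This provides the competitors: every control, together with solutions of the two steering equations,
  defines a horizontal curve.
\<close>

lemma bicycling_horizontal_curve:
  assumes l: "l1 > 0" "l2 > 0" and v: "continuous_on I v"
    and x: "\<And>t. t \<in> I \<Longrightarrow> (x has_vector_derivative v t) (at t within I)"
    and q: "bicycling l1 I v q1" "bicycling l2 I v q2"
  shows "horizontal_curve l1 l2 I (\<lambda>t. linkage_at l1 l2 (x t) (q1 t) (q2 t))"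
proof -
  have dq: "(q1 has_vector_derivative (Im (v t * cnj (q1 t)) / l1) *\<^sub>R (\<i> * q1 t)) (at t within I)"
    "(q2 has_vector_derivative (Im (v t * cnj (q2 t)) / l2) *\<^sub>R (\<i> * q2 t)) (at t within I)"
    "norm (q1 t) = 1" "norm (q2 t) = 1" if "t \<in> I" for t
    using q that unfolding bicycling_def by blast+
  have cq: "continuous_on I q1" "continuous_on I q2"
    using dq by (intro continuous_on_vector_derivative; blast)+
  have along: "\<exists>k::real. v - l *\<^sub>R ((Im (v * cnj q) / l) *\<^sub>R (\<i> * q)) = k *\<^sub>R ((x - l *\<^sub>R q) - x)"
    if "norm q = 1" "l > 0" for v x q :: complex and l
  proof -
    obtain R M where RM: "R = Re (v * cnj q)" "M = Im (v * cnj q)" by blast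
    have 1: "q * cnj q = 1" using that(1) complex_norm_square[of q] by simp
    have "v = (v * cnj q) * q" using 1 by (simp add: mult.assoc mult.commute[of "cnj q"])
    also have "v * cnj q = of_real R + \<i> * of_real M"
      unfolding RM by (rule complex_eq)
    finally have "v = of_real R * q + \<i> * of_real M * q" by (simp add: algebra_simps)
    then have "v - l *\<^sub>R ((M / l) *\<^sub>R (\<i> * q)) = (- (R / l)) *\<^sub>R ((x - l *\<^sub>R q) - x)"
      using that(2) by (simp add: scaleR_conv_of_real)
    then show ?thesis unfolding RM by blast
  qed
  let ?d = "\<lambda>t. (v t, v t - l1 *\<^sub>R ((Im (v t * cnj (q1 t)) / l1) *\<^sub>R (\<i> * q1 t)),
      v t - l2 *\<^sub>R ((Im (v t * cnj (q2 t)) / l2) *\<^sub>R (\<i> * q2 t)))"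
  show ?thesis
    unfolding horizontal_curve_def
  proof (intro conjI exI[of _ ?d] ballI)
    show "(\<lambda>t. linkage_at l1 l2 (x t) (q1 t) (q2 t)) ` I \<subseteq> linkages l1 l2"
      using dq(3,4) l by (auto simp: linkage_at_def linkages_def dist_norm)
    show "continuous_on I ?d"
      using l by (intro continuous_intros v cq) auto
    fix t assume t: "t \<in> I"
    show "((\<lambda>t. linkage_at l1 l2 (x t) (q1 t) (q2 t)) has_vector_derivative ?d t) (at t within I)"
      unfolding linkage_at_def
      by (intro has_vector_derivative_Pair has_vector_derivative_diff x[OF t] dq(1,2)[OF t]
        bounded_linear.has_vector_derivative[OF bounded_linear_scaleR_right])
    show "case (linkage_at l1 l2 (x t) (q1 t) (q2 t), ?d t) of
      ((x, m1, m2), (x', m1', m2')) \<Rightarrow>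
              (\<exists>k::real. m1' = k *\<^sub>R (m1 - x)) \<and>
              (\<exists>k::real. m2' = k *\<^sub>R (m2 - x))"
      unfolding linkage_at_def using along[OF dq(3)[OF t] l(1)] along[OF dq(4)[OF t] l(2)] by simp
  qed
qed

lemma horizontal_length_eq:
  assumes "a < b"
    and "\<And>t. t \<in> {a..b} \<Longrightarrow> ((pt_x \<circ> \<gamma>) has_vector_derivative v t) (at t within {a..b})"
  shows "horizontal_length a b \<gamma> = integral {a..b} (\<lambda>t. norm (v t))"
  unfolding horizontal_length_def
  by (rule integral_cong) (simp add: vector_derivative_within_closed_interval[OF assms(1) _ assms(2)])

text \<open>
  The first order condition for minimizing arcs, normal and abnormal at once.  The map \<open>F\<close> in the proof
  sends a control to the end point of \<open>x\<close>, the two final angles, scaled by \<open>g\<^sub>i b\<close>, and the length.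
  If \<open>F\<close> were open at the control of the arc, the same end point would be reached with smaller length.  A
  vector orthogonal to the range of the derivative of \<open>F\<close> is the multiplier; testing it with
  the control \<open>n0 u + p + n1 V\<^sub>1 + n2 V\<^sub>2\<close> shows that this function vanishes.
\<close>

lemma minimizing_imp_multiplier:
  assumes l: "l1 > 0" "l2 > 0" and ab: "a < b" "b - a \<le> l1 / 4" "b - a \<le> l2 / 4"
    and u: "continuous_on {a..b} u" "\<And>t. t \<in> {a..b} \<Longrightarrow> norm (u t) = 1"
    and x: "\<And>t. t \<in> {a..b} \<Longrightarrow> (x has_vector_derivative u t) (at t within {a..b})"
    and q: "bicycling l1 {a..b} u q1" "bicycling l2 {a..b} u q2"
    and g1: "\<And>t. t \<in> {a..b} \<Longrightarrow> g1 t > 0"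
        "\<And>t. t \<in> {a..b} \<Longrightarrow> (g1 has_real_derivative Re (u t * cnj (q1 t)) / l1 * g1 t) (at t within {a..b})"
    and g2: "\<And>t. t \<in> {a..b} \<Longrightarrow> g2 t > 0"
        "\<And>t. t \<in> {a..b} \<Longrightarrow> (g2 has_real_derivative Re (u t * cnj (q2 t)) / l2 * g2 t) (at t within {a..b})"
    and min: "length_minimizing l1 l2 a b (\<lambda>t. linkage_at l1 l2 (x t) (q1 t) (q2 t))"
  obtains n0 n1 n2 :: real and p :: complex where "\<not> (n0 = 0 \<and> n1 = 0 \<and> n2 = 0 \<and> p = 0)"
    "\<And>t. t \<in> {a..b} \<Longrightarrow> n0 *\<^sub>R u t + p + (n1 * g1 t / l1) *\<^sub>R (\<i> * q1 t) + (n2 * g2 t / l2) *\<^sub>R (\<i> * q2 t) = 0"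
proof -
  have ab': "a \<le> b" using ab by simp
  obtain U :: "real \<Rightarrow>\<^sub>C complex" where U: "\<And>t. t \<in> {a..b} \<Longrightarrow> U t = u t"
    using continuous_on_cbox_bcontfunE[of a b u] u(1) by (metis box_real(2))
  have nU: "norm (U t) = 1" if "t \<in> {a..b}" for t using U u(2) that by simp
  obtain \<phi>1 where \<phi>1: "steered l1 a b u \<phi>1" "\<And>t. t \<in> {a..b} \<Longrightarrow> q1 t = cis (\<phi>1 t)"
    using bicycling_lift[OF ab' u(1) q(1)] by blast
  obtain \<phi>2 where \<phi>2: "steered l2 a b u \<phi>2" "\<And>t. t \<in> {a..b} \<Longrightarrow> q2 t = cis (\<phi>2 t)"
    using bicycling_lift[OF ab' u(1) q(2)] by blast
  have le2: "norm (apply_bcontfun v t) \<le> 2" if "v \<in> ball U 1" "t \<in> {a..b}" for v t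
  proof -
    have "norm (v t) \<le> norm (U t) + norm (v t - U t)" using norm_triangle_sub by blast
    also have "norm (v t - U t) \<le> dist v U" using dist_bounded[of v t U] by (simp add: dist_norm)
    finally show ?thesis using nU[OF that(2)] that(1) by (simp add: dist_commute)
  qed
  have ex: "\<exists>sol :: (real \<Rightarrow>\<^sub>C complex) \<Rightarrow> real \<Rightarrow> real.
      \<forall>v :: real \<Rightarrow>\<^sub>C complex. v \<in> ball U 1 \<longrightarrow> steered l a b (apply_bcontfun v) (sol v) \<and> sol v a = \<alpha>"
    if "l > 0" "b - a \<le> l / 4" for l \<alpha>
  proof (rule choice, rule allI)
    fix v
    show "\<exists>\<phi>. v \<in> ball U 1 \<longrightarrow> steered l a b (apply_bcontfun v) \<phi> \<and> \<phi> a = \<alpha>"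
      using steered_exists[OF that(1) ab(1) that(2), of "apply_bcontfun v" \<alpha>] le2[of v] by auto
  qed
  obtain sol1 :: "(real \<Rightarrow>\<^sub>C complex) \<Rightarrow> real \<Rightarrow> real" where sol1: "\<And>v. v \<in> ball U 1 \<Longrightarrow> steered l1 a b v (sol1 v)" "\<And>v. v \<in> ball U 1 \<Longrightarrow> sol1 v a = \<phi>1 a"
    using ex[OF l(1) ab(2)] by metis
  obtain sol2 :: "(real \<Rightarrow>\<^sub>C complex) \<Rightarrow> real \<Rightarrow> real" where sol2: "\<And>v. v \<in> ball U 1 \<Longrightarrow> steered l2 a b v (sol2 v)" "\<And>v. v \<in> ball U 1 \<Longrightarrow> sol2 v a = \<phi>2 a"
    using ex[OF l(2) ab(3)] by metis
  have UU: "U \<in> ball U 1" by simp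
  have s1: "sol1 U t = \<phi>1 t" if t: "t \<in> {a..b}" for t
    using steered_diff_le[OF l(1) ab' ab(2) sol1(1)[OF UU] \<phi>1(1) sol1(2)[OF UU] _ _ t, of 0] u(2) U by simp
  have s2: "sol2 U t = \<phi>2 t" if t: "t \<in> {a..b}" for t
    using steered_diff_le[OF l(2) ab' ab(3) sol2(1)[OF UU] \<phi>2(1) sol2(2)[OF UU] _ _ t, of 0] u(2) U by simp
  define F where "F = (\<lambda>v :: real \<Rightarrow>\<^sub>C complex. (integral {a..b} (apply_bcontfun v), g1 b * sol1 v b, g2 b * sol2 v b,
      integral {a..b} (\<lambda>t. norm (apply_bcontfun v t))))"
  define F' where "F' = (\<lambda>w :: real \<Rightarrow>\<^sub>C complex. (integral {a..b} (apply_bcontfun w),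
      integral {a..b} (\<lambda>t. w t \<bullet> ((g1 t / l1) *\<^sub>R (\<i> * cis (sol1 U t)))),
      integral {a..b} (\<lambda>t. w t \<bullet> ((g2 t / l2) *\<^sub>R (\<i> * cis (sol2 U t)))),
      integral {a..b} (\<lambda>t. w t \<bullet> U t)))"
  have gg1: "(g1 has_real_derivative Re (U t * cis (- sol1 U t)) / l1 * g1 t) (at t within {a..b})" if "t \<in> {a..b}" for t
    using g1(2)[OF that] \<phi>1(2)[OF that] s1[OF that] U[OF that] by (simp only: cis_cnj)
  have gg2: "(g2 has_real_derivative Re (U t * cis (- sol2 U t)) / l2 * g2 t) (at t within {a..b})" if "t \<in> {a..b}" for t
    using g2(2)[OF that] \<phi>2(2)[OF that] s2[OF that] U[OF that] by (simp only: cis_cnj)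
  note A1 = endpoint_angle_first_variation[OF l(1) ab' ab(2) nU sol1 gg1]
  note A2 = endpoint_angle_first_variation[OF l(2) ab' ab(3) nU sol2 gg2]
  have contF: "continuous_on (ball U 1) F"
    unfolding F_def
    by (intro continuous_on_Pair A1(1) A2(1) continuous_on_length[OF ab'])
      (rule linear_continuous_on[OF bounded_linear_integral_bcontfun[OF ab']])
  have derF: "(F has_derivative F') (at U)"
    unfolding F_def F'_def
    by (intro has_derivative_Pair A1(2) A2(2) length_first_variation[OF ab' nU]
      bounded_linear_imp_has_derivative[OF bounded_linear_integral_bcontfun[OF ab']])
  have "F U \<notin> interior (F ` ball U 1)"
  proof
    assume "F U \<in> interior (F ` ball U 1)"
    then obtain e where e: "e > 0" "cball (F U) e \<subseteq> F ` ball U 1"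
      by (auto simp: mem_interior_cball)
    have "F U - (0, 0, 0, e) \<in> cball (F U) e" using e(1) by (simp add: dist_norm norm_Pair)
    then have "F U - (0, 0, 0, e) \<in> F ` ball U 1" using e(2) by (rule rev_subsetD)
    then obtain v where v: "v \<in> ball U 1" "F v = F U - (0, 0, 0, e)" by (metis imageE)
    have iU: "integral {a..b} (apply_bcontfun U) = integral {a..b} u"
      "integral {a..b} (\<lambda>t. norm (U t)) = b - a"
    proof -
      show "integral {a..b} (apply_bcontfun U) = integral {a..b} u" by (rule integral_cong) (rule U)
      have "integral {a..b} (\<lambda>t. norm (U t)) = integral {a..b} (\<lambda>t. 1)" by (rule integral_cong) (rule nU)
      then show "integral {a..b} (\<lambda>t. norm (U t)) = b - a" using ab' by simp
    qed
    have iu: "integral {a..b} u = x b - x a"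
      using fundamental_theorem_of_calculus[OF ab' x] by (rule integral_unique)
    have Fv: "integral {a..b} (apply_bcontfun v) = x b - x a" "sol1 v b = \<phi>1 b" "sol2 v b = \<phi>2 b"
       "integral {a..b} (\<lambda>t. norm (v t)) = b - a - e"
      using v(2) g1(1)[of b] g2(1)[of b] ab' s1[of b] s2[of b]
      unfolding F_def iU iu by auto
    define X where "X t = x a + integral {a..t} (apply_bcontfun v)" for t
    have X: "(X has_vector_derivative v t) (at t within {a..b})" if "t \<in> {a..b}" for t
      unfolding X_def using integral_has_vector_derivative[OF _ that, of "apply_bcontfun v"]
      by (auto intro!: derivative_eq_intros)
    let ?\<delta> = "\<lambda>t. linkage_at l1 l2 (X t) (cis (sol1 v t)) (cis (sol2 v t))"
    let ?\<gamma> = "\<lambda>t. linkage_at l1 l2 (x t) (q1 t) (q2 t)"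
    have hc: "horizontal_curve l1 l2 {a..b} ?\<delta>"
      by (rule bicycling_horizontal_curve[OF l _ X steered_imp_bicycling[OF sol1(1)[OF v(1)]]
          steered_imp_bicycling[OF sol2(1)[OF v(1)]]]) auto
    have "?\<delta> a = ?\<gamma> a" "?\<delta> b = ?\<gamma> b"
      using Fv sol1(2)[OF v(1)] sol2(2)[OF v(1)] \<phi>1(2) \<phi>2(2) ab' by (auto simp: X_def)
    then have "horizontal_length a b ?\<gamma> \<le> horizontal_length a b ?\<delta>"
      using min hc ab(1) unfolding length_minimizing_def by blast
    moreover have "horizontal_length a b ?\<gamma> = integral {a..b} (\<lambda>t. norm (u t))"
      by (rule horizontal_length_eq[OF ab(1)]) (use x in \<open>simp add: pt_x_def linkage_at_def o_def\<close>)
    moreover have "integral {a..b} (\<lambda>t. norm (u t)) = b - a"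
      using iU(2) U by (metis (no_types, lifting) integral_cong)
    moreover have "horizontal_length a b ?\<delta> = integral {a..b} (\<lambda>t. norm (v t))"
      by (rule horizontal_length_eq[OF ab(1)]) (use X in \<open>simp add: pt_x_def linkage_at_def o_def\<close>)
    ultimately show False using Fv(4) e(1) by simp
  qed
  then obtain z where z: "z \<noteq> 0" "\<And>w. z \<bullet> F' w = 0"
    using open_map_or_multiplier[OF open_ball UU contF derF] by blast
  obtain p n1 n2 n0 where zz: "z = (p, n1, n2, n0)" by (cases z) auto
  let ?Z = "\<lambda>t. n0 *\<^sub>R u t + p + (n1 * g1 t / l1) *\<^sub>R (\<i> * q1 t) + (n2 * g2 t / l2) *\<^sub>R (\<i> * q2 t)"
  have cont: "continuous_on {a..b} g1" "continuous_on {a..b} g2"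
    by (rule DERIV_continuous_on, rule g1(2), simp, rule DERIV_continuous_on, rule g2(2), simp)
  have cq: "continuous_on {a..b} q1" "continuous_on {a..b} q2"
    using q unfolding bicycling_def by (intro continuous_on_vector_derivative; blast)+
  have contZ: "continuous_on {a..b} ?Z"
    using l by (intro continuous_intros cont cq u(1)) auto
  obtain W :: "real \<Rightarrow>\<^sub>C complex" where W: "\<And>t. t \<in> {a..b} \<Longrightarrow> W t = ?Z t"
    using continuous_on_cbox_bcontfunE[of a b ?Z] contZ by (metis (no_types, lifting) box_real(2))
  have i1: "apply_bcontfun W integrable_on {a..b}"
    by (intro integrable_continuous_real) auto
  have i2: "(\<lambda>t. W t \<bullet> ((g1 t / l1) *\<^sub>R (\<i> * cis (sol1 U t)))) integrable_on {a..b}"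
    using l by (intro integrable_continuous_real continuous_intros cont steered_continuous_on[OF sol1(1)[OF UU]]) auto
  have i3: "(\<lambda>t. W t \<bullet> ((g2 t / l2) *\<^sub>R (\<i> * cis (sol2 U t)))) integrable_on {a..b}"
    using l by (intro integrable_continuous_real continuous_intros cont steered_continuous_on[OF sol2(1)[OF UU]]) auto
  have i4: "(\<lambda>t. W t \<bullet> U t) integrable_on {a..b}"
    by (intro integrable_continuous_real continuous_intros) auto
  have i5: "(\<lambda>t. p \<bullet> W t) integrable_on {a..b}" "p \<bullet> integral {a..b} W = integral {a..b} (\<lambda>t. p \<bullet> W t)"
    using integrable_linear[OF i1 bounded_linear_inner_right[of p]]
      integral_linear[OF i1 bounded_linear_inner_right[of p]] by (simp_all add: o_def)
  have hi: "((\<lambda>t. p \<bullet> W t + n1 * (W t \<bullet> ((g1 t / l1) *\<^sub>R (\<i> * cis (sol1 U t))))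
     + n2 * (W t \<bullet> ((g2 t / l2) *\<^sub>R (\<i> * cis (sol2 U t)))) + n0 * (W t \<bullet> U t)) has_integral
     integral {a..b} (\<lambda>t. p \<bullet> W t)
     + n1 * integral {a..b} (\<lambda>t. W t \<bullet> ((g1 t / l1) *\<^sub>R (\<i> * cis (sol1 U t))))
     + n2 * integral {a..b} (\<lambda>t. W t \<bullet> ((g2 t / l2) *\<^sub>R (\<i> * cis (sol2 U t))))
     + n0 * integral {a..b} (\<lambda>t. W t \<bullet> U t)) {a..b}"
    by (intro has_integral_add has_integral_mult_right integrable_integral i2 i3 i4 i5(1))
  have "0 = z \<bullet> F' W" using z(2) by simp
  also have "\<dots> = integral {a..b} (\<lambda>t. p \<bullet> W t)
     + n1 * integral {a..b} (\<lambda>t. W t \<bullet> ((g1 t / l1) *\<^sub>R (\<i> * cis (sol1 U t))))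
     + n2 * integral {a..b} (\<lambda>t. W t \<bullet> ((g2 t / l2) *\<^sub>R (\<i> * cis (sol2 U t))))
     + n0 * integral {a..b} (\<lambda>t. W t \<bullet> U t)"
    unfolding i5(2)[symmetric] by (simp only: zz F'_def inner_Pair inner_real_def add.assoc)
  also have "\<dots> = integral {a..b} (\<lambda>t. ?Z t \<bullet> ?Z t)"
    unfolding integral_unique[OF hi, symmetric]
  proof (rule integral_cong)
    fix t assume t: "t \<in> {a..b}"
    have expand: "p \<bullet> w + n1 * (w \<bullet> ((c1 / l1) *\<^sub>R A)) + n2 * (w \<bullet> ((c2 / l2) *\<^sub>R B)) + n0 * (w \<bullet> C)
       = w \<bullet> (n0 *\<^sub>R C + p + (n1 * c1 / l1) *\<^sub>R A + (n2 * c2 / l2) *\<^sub>R B)" for w A B C :: complex and c1 c2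
      by (simp add: inner_add_right inner_commute[of p])
    show "p \<bullet> W t + n1 * (W t \<bullet> ((g1 t / l1) *\<^sub>R (\<i> * cis (sol1 U t))))
       + n2 * (W t \<bullet> ((g2 t / l2) *\<^sub>R (\<i> * cis (sol2 U t)))) + n0 * (W t \<bullet> U t) = ?Z t \<bullet> ?Z t"
      unfolding expand s1[OF t] s2[OF t] U[OF t] \<phi>1(2)[OF t, symmetric] \<phi>2(2)[OF t, symmetric] W[OF t] ..
  qed
  finally have "\<forall>t\<in>{a..b}. ?Z t \<bullet> ?Z t = 0"
    using integral_eq_0_iff[of a b "\<lambda>t. ?Z t \<bullet> ?Z t"] ab(1) contZ by (simp add: continuous_on_inner)
  moreover have "\<not> (n0 = 0 \<and> n1 = 0 \<and> n2 = 0 \<and> p = 0)" using z(1) zz by (auto simp: zero_prod_def)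
  ultimately show thesis using that[of n0 n1 n2 p] by simp
qed

section \<open>Normal and abnormal arcs\<close>

lemma zero_by_gronwall:
  fixes E :: "real \<Rightarrow> real"
  assumes E: "\<And>t. t \<in> {a..b} \<Longrightarrow> (E has_real_derivative E' t) (at t within {a..b})"
    and nonneg: "\<And>t. t \<in> {a..b} \<Longrightarrow> 0 \<le> E t"
    and bound: "\<And>t. t \<in> {a..b} \<Longrightarrow> \<bar>E' t\<bar> \<le> K * E t"
    and r: "r \<in> {a..b}" "E r = 0" and t: "t \<in> {a..b}"
  shows "E t = 0"
proof -
  have d: "((\<lambda>t. E t * exp (k * t)) has_real_derivative (E' t + k * E t) * exp (k * t)) (at t within {a..b})"
    if "t \<in> {a..b}" for k t
    by (rule derivative_eq_intros E that refl)+ (simp add: algebra_simps)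
  have d': "((\<lambda>t. E t * exp (k * t)) has_real_derivative (E' t + k * E t) * exp (k * t)) (at t)"
    if "a < t" "t < b" for k t
    using d[of t k] that by (simp add: at_within_Icc_at)
  have c: "continuous_on S (\<lambda>t. E t * exp (k * t))" if "S \<subseteq> {a..b}" for S k
    by (rule continuous_on_subset[OF DERIV_continuous_on[OF d] that])
  have "E t \<le> 0"
  proof (cases "r \<le> t")
    case True
    have "E t * exp (- K * t) \<le> E r * exp (- K * r)"
    proof (rule DERIV_nonpos_imp_decreasing_open[OF True])
      fix z assume z: "r < z" "z < t"
      then have "z \<in> {a..b}" "a < z" "z < b" using r t by auto
      then show "\<exists>y. ((\<lambda>t. E t * exp (- K * t)) has_real_derivative y) (at z) \<and> y \<le> 0"
        using d'[of z "- K"] bound[of z] by (intro exI conjI) (auto simp: mult_le_0_iff)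
    qed (rule c, use r t in auto)
    then show ?thesis using r(2) by (simp add: mult_le_0_iff)
  next
    case False
    then have tr: "t \<le> r" by simp
    have "E t * exp (K * t) \<le> E r * exp (K * r)"
    proof (rule DERIV_nonneg_imp_increasing_open[OF tr])
      fix z assume z: "t < z" "z < r"
      then have "z \<in> {a..b}" "a < z" "z < b" using r t by auto
      then show "\<exists>y. ((\<lambda>t. E t * exp (K * t)) has_real_derivative y) (at z) \<and> y \<ge> 0"
        using d'[of z K] bound[of z] by (intro exI conjI) (auto simp: zero_le_mult_iff)
    qed (rule c, use r t in auto)
    then show ?thesis using r(2) by (simp add: mult_le_0_iff)
  qed
  then show ?thesis using nonneg[OF t] by simp
qed

text \<open>
  The normal and tangential components of the velocity relative to the segment, divided by its length:
  the angular velocity of the segment, and the speed of its back end in units of \<open>l\<close>.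
\<close>

definition turning_rate :: "real \<Rightarrow> (real \<Rightarrow> complex) \<Rightarrow> (real \<Rightarrow> complex) \<Rightarrow> real \<Rightarrow> real" where
  "turning_rate l u q t = Im (u t * cnj (q t)) / l"

definition rolling_rate :: "real \<Rightarrow> (real \<Rightarrow> complex) \<Rightarrow> (real \<Rightarrow> complex) \<Rightarrow> real \<Rightarrow> real" where
  "rolling_rate l u q t = Re (u t * cnj (q t)) / l"

lemma rates_complex:
  assumes "l \<noteq> 0" "norm (q t) = 1"
  shows "u t = l *\<^sub>R (Complex (rolling_rate l u q t) (turning_rate l u q t) * q t)"
proof -
  have "q t * cnj (q t) = 1" using assms(2) complex_norm_square[of "q t"] by simp
  then have "u t = (u t * cnj (q t)) * q t" by (simp add: mult.assoc mult.commute[of "cnj (q t)"])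
  also have "u t * cnj (q t) = l *\<^sub>R Complex (rolling_rate l u q t) (turning_rate l u q t)"
    using assms(1) by (simp add: rolling_rate_def turning_rate_def complex_eq_iff)
  finally show ?thesis by simp
qed

lemma direction_eq:
  assumes "l \<noteq> 0" "norm (u t) = 1"
  shows "q t = l *\<^sub>R (Complex (rolling_rate l u q t) (- turning_rate l u q t) * u t)"
proof -
  have "u t * cnj (u t) = 1" using assms(2) complex_norm_square[of "u t"] by simp
  then have "q t = (q t * cnj (u t)) * u t" by (simp add: mult.assoc mult.commute[of "cnj (u t)"])
  also have "q t * cnj (u t) = l *\<^sub>R Complex (rolling_rate l u q t) (- turning_rate l u q t)"
    using assms(1) by (simp add: rolling_rate_def turning_rate_def complex_eq_iff field_simps)
  finally show ?thesis by simp
qed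

lemma rates_norm:
  assumes "l \<noteq> 0" "norm (q t) = 1" "norm (u t) = 1"
  shows "(turning_rate l u q t)\<^sup>2 + (rolling_rate l u q t)\<^sup>2 = 1 / l\<^sup>2"
proof -
  have "(Re (u t * cnj (q t)))\<^sup>2 + (Im (u t * cnj (q t)))\<^sup>2 = (norm (u t * cnj (q t)))\<^sup>2"
    by (simp add: cmod_power2)
  also have "\<dots> = 1" using assms by (simp add: norm_mult)
  finally show ?thesis
    unfolding turning_rate_def rolling_rate_def power_divide add_divide_distrib[symmetric] by (simp add: add.commute)
qed

lemma rates_deriv:
  assumes l: "l \<noteq> 0" and t: "t \<in> S" and q: "bicycling l S u q"
    and u: "(u has_vector_derivative \<kappa> *\<^sub>R (\<i> * u t)) (at t within S)"
  shows "(turning_rate l u q has_real_derivative (\<kappa> - turning_rate l u q t) * rolling_rate l u q t) (at t within S)"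
    and "(rolling_rate l u q has_real_derivative - (\<kappa> - turning_rate l u q t) * turning_rate l u q t) (at t within S)"
proof -
  have dq: "(q has_vector_derivative (turning_rate l u q t) *\<^sub>R (\<i> * q t)) (at t within S)"
    using q t unfolding bicycling_def turning_rate_def by blast
  let ?z = "\<lambda>t. u t * cnj (q t)"
  have "(?z has_vector_derivative (\<kappa> - turning_rate l u q t) *\<^sub>R (\<i> * ?z t)) (at t within S)"
    by (rule has_vector_derivative_eq_rhs[OF has_vector_derivative_mult[OF u has_vector_derivative_cnj[OF dq]]])
      (simp add: scaleR_conv_of_real algebra_simps)
  then have "((\<lambda>t. Im (?z t)) has_real_derivative (\<kappa> - turning_rate l u q t) * Re (?z t)) (at t within S)"
    "((\<lambda>t. Re (?z t)) has_real_derivative (\<kappa> - turning_rate l u q t) * - Im (?z t)) (at t within S)"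
    using bounded_linear.has_vector_derivative[OF bounded_linear_Im, of ?z]
      bounded_linear.has_vector_derivative[OF bounded_linear_Re, of ?z]
    by (force simp: has_real_derivative_iff_has_vector_derivative)+
  note this[THEN DERIV_cdivide, of l]
  moreover have "(\<kappa> - turning_rate l u q t) * Re (?z t) / l = (\<kappa> - turning_rate l u q t) * rolling_rate l u q t"
    "(\<kappa> - turning_rate l u q t) * - Im (?z t) / l = - (\<kappa> - turning_rate l u q t) * turning_rate l u q t"
    unfolding turning_rate_def rolling_rate_def
    by (simp_all only: times_divide_eq_right mult_minus_left mult_minus_right minus_divide_left)
  ultimately show "(turning_rate l u q has_real_derivative (\<kappa> - turning_rate l u q t) * rolling_rate l u q t) (at t within S)"
    "(rolling_rate l u q has_real_derivative - (\<kappa> - turning_rate l u q t) * turning_rate l u q t) (at t within S)"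
    unfolding turning_rate_def[of l u q, abs_def] rolling_rate_def[of l u q, abs_def] by (simp_all only:)
qed

text \<open>
  The reason for the weight \<open>g\<close>: it makes the derivative of the variation field \<open>V\<^sub>i\<close> normal to the path
  of \<open>x\<close>, for both segments.  A linear relation among \<open>u\<close>, \<open>V\<^sub>1\<close>, \<open>V\<^sub>2\<close> and a constant can
  therefore be differentiated to a scalar relation.
\<close>

lemma lever_deriv:
  assumes l: "l \<noteq> 0" and t: "t \<in> S" and q: "bicycling l S u q"
    and g: "(g has_real_derivative rolling_rate l u q t * g t) (at t within S)"
  shows "((\<lambda>t. (g t / l) *\<^sub>R (\<i> * q t)) has_vector_derivative (g t / l\<^sup>2) *\<^sub>R (\<i> * u t)) (at t within S)"
proof -
  have dq: "(q has_vector_derivative (turning_rate l u q t) *\<^sub>R (\<i> * q t)) (at t within S)" and nq: "norm (q t) = 1"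
    using q t unfolding bicycling_def turning_rate_def by blast+
  obtain R M where RM: "R = rolling_rate l u q t" "M = turning_rate l u q t" by blast
  have u: "u t = l *\<^sub>R (Complex R M * q t)" unfolding RM by (rule rates_complex[of l q t u, OF l nq])
  have "((\<lambda>t. (g t / l) *\<^sub>R (\<i> * q t)) has_vector_derivative
     (g t / l) *\<^sub>R (\<i> * (M *\<^sub>R (\<i> * q t))) + (R * g t / l) *\<^sub>R (\<i> * q t)) (at t within S)"
    unfolding RM
    by (rule has_vector_derivative_scaleR[OF DERIV_cdivide[OF g] has_vector_derivative_mult_right[OF dq]])
  moreover have "(g t / l) *\<^sub>R (\<i> * (M *\<^sub>R (\<i> * q t))) + (R * g t / l) *\<^sub>R (\<i> * q t) = (g t / l\<^sup>2) *\<^sub>R (\<i> * u t)"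
    unfolding u using l by (simp add: complex_eq_iff field_simps power2_eq_square)
  ultimately show ?thesis by simp
qed


lemma vector_derivative_unique_Icc:
  assumes "a < b" "t \<in> {a..b}"
    and "(f has_vector_derivative d) (at t within {a..b})" "(f has_vector_derivative d') (at t within {a..b})"
  shows "d = d'"
  using vector_derivative_unique_within_closed_interval[of a b t f d d'] assms by simp

lemma real_derivative_unique_Icc:
  fixes f :: "real \<Rightarrow> real"
  assumes "a < b" "t \<in> {a..b}"
    and "(f has_real_derivative d) (at t within {a..b})" "(f has_real_derivative d') (at t within {a..b})"
  shows "d = d'"
  using vector_derivative_unique_Icc[of a b t f d d'] assms
  by (simp add: has_real_derivative_iff_has_vector_derivative)

text \<open>A horizontal unit speed motion of the linkage, with the integrating factors of both segments.\<close>

locale linkage_motion =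
  fixes l1 l2 :: real and I :: "real set" and u q1 q2 :: "real \<Rightarrow> complex" and g1 g2 :: "real \<Rightarrow> real"
  assumes l: "l1 > 0" "l2 > 0" "l1 \<noteq> l2"
    and I: "is_interval I" "\<exists>s\<in>I. \<exists>t\<in>I. s < t"
    and u: "continuous_on I u" "\<And>t. t \<in> I \<Longrightarrow> norm (u t) = 1"
    and q: "bicycling l1 I u q1" "bicycling l2 I u q2"
    and g1: "\<And>t. t \<in> I \<Longrightarrow> g1 t > 0" "\<And>t. t \<in> I \<Longrightarrow> (g1 has_real_derivative rolling_rate l1 u q1 t * g1 t) (at t within I)"
    and g2: "\<And>t. t \<in> I \<Longrightarrow> g2 t > 0" "\<And>t. t \<in> I \<Longrightarrow> (g2 has_real_derivative rolling_rate l2 u q2 t * g2 t) (at t within I)"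
begin

abbreviation "s1 \<equiv> turning_rate l1 u q1"
abbreviation "s2 \<equiv> turning_rate l2 u q2"
abbreviation "c1 \<equiv> rolling_rate l1 u q1"
abbreviation "c2 \<equiv> rolling_rate l2 u q2"

text \<open>
  The curvature that a normal multiplier \<open>(m1, m2)\<close> prescribes for the path of \<open>x\<close>.
\<close>

definition curvature_of :: "real \<Rightarrow> real \<Rightarrow> real \<Rightarrow> real" where
  "curvature_of m1 m2 t = m1 * g1 t / l1\<^sup>2 + m2 * g2 t / l2\<^sup>2"

definition normal_on :: "real set \<Rightarrow> real \<Rightarrow> real \<Rightarrow> bool" where
  "normal_on S m1 m2 \<longleftrightarrow>
     (\<forall>t\<in>S. (u has_vector_derivative curvature_of m1 m2 t *\<^sub>R (\<i> * u t)) (at t within S))"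

text \<open>
  The equality \<open>c1 = c2\<close> means that \<open>u\<close> is orthogonal to \<open>q1 / l1 - q2 / l2\<close>.  The integral curves of this
  line field are the singular curves of the horizontal distribution.
\<close>

definition abnormal_on :: "real set \<Rightarrow> bool" where
  "abnormal_on S \<longleftrightarrow> (\<forall>t\<in>S. c1 t = c2 t)"

lemma bicycling_subset: "bicycling l I u q \<Longrightarrow> S \<subseteq> I \<Longrightarrow> bicycling l S u q"
  unfolding bicycling_def by (blast intro: has_vector_derivative_within_subset)

lemma norms: "norm (q1 t) = 1" "norm (q2 t) = 1" if "t \<in> I"
  using q that unfolding bicycling_def by blast+

lemma continuous_on_components:
  "continuous_on I q1" "continuous_on I q2"
  "continuous_on I s1" "continuous_on I s2" "continuous_on I c1" "continuous_on I c2"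
  "continuous_on I g1" "continuous_on I g2"
proof -
  show 1: "continuous_on I q1" "continuous_on I q2"
    using q unfolding bicycling_def by (intro continuous_on_vector_derivative; blast)+
  show "continuous_on I s1" "continuous_on I s2" "continuous_on I c1" "continuous_on I c2"
    unfolding turning_rate_def[abs_def] rolling_rate_def[abs_def] divide_inverse by (intro continuous_intros u(1) 1)+
  show "continuous_on I g1" "continuous_on I g2"
    by (rule DERIV_continuous_on, rule g1(2), simp, rule DERIV_continuous_on, rule g2(2), simp)
qed

lemma component_norms:
  assumes "t \<in> I"
  shows "(s1 t)\<^sup>2 + (c1 t)\<^sup>2 = 1 / l1\<^sup>2" "(s2 t)\<^sup>2 + (c2 t)\<^sup>2 = 1 / l2\<^sup>2"
  using rates_norm[of l1 q1 t u] rates_norm[of l2 q2 t u] l norms[OF assms] u(2)[OF assms] by auto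

text \<open>
  This is where \<open>l1 \<noteq> l2\<close> enters: the vectors \<open>(s1, c1)\<close> and \<open>(s2, c2)\<close> have the different lengths
  \<open>1 / l1\<close> and \<open>1 / l2\<close>.
\<close>

lemma turning_rates_differ: "t \<in> I \<Longrightarrow> c1 t = c2 t \<Longrightarrow> s1 t \<noteq> s2 t"
  using component_norms[of t] l by (auto simp: power2_eq_iff)

text \<open>If a nontrivial combination of \<open>g1\<close> and \<open>g2\<close> vanishes, their logarithmic derivatives \<open>c1\<close> and \<open>c2\<close> agree.\<close>

lemma dependent_levers_imp_abnormal:
  assumes ab: "a < b" "{a..b} \<subseteq> I" and k: "\<not> (k1 = 0 \<and> k2 = 0)"
    and zero: "\<And>t. t \<in> {a..b} \<Longrightarrow> curvature_of k1 k2 t = 0"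
  shows "abnormal_on {a..b}"
  unfolding abnormal_on_def
proof
  fix t assume t: "t \<in> {a..b}"
  then have tI: "t \<in> I" using ab by blast
  have "(curvature_of k1 k2 has_real_derivative k1 * (c1 t * g1 t) / l1\<^sup>2 + k2 * (c2 t * g2 t) / l2\<^sup>2) (at t within {a..b})"
    unfolding curvature_of_def[abs_def]
    by (intro DERIV_add DERIV_cdivide DERIV_cmult DERIV_subset[OF g1(2) ab(2)] DERIV_subset[OF g2(2) ab(2)] tI)
  moreover have "(curvature_of k1 k2 has_real_derivative 0) (at t within {a..b})"
    by (rule has_field_derivative_transform_within[of "\<lambda>_. 0" _ _ _ 1]) (use t zero in auto)
  ultimately have "k1 * (c1 t * g1 t) / l1\<^sup>2 + k2 * (c2 t * g2 t) / l2\<^sup>2 = 0"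
    by (rule real_derivative_unique_Icc[OF ab(1) t])
  moreover have "k2 * g2 t / l2\<^sup>2 = - (k1 * g1 t / l1\<^sup>2)" using zero[OF t] by (simp add: curvature_of_def)
  moreover have "k2 * (c2 t * g2 t) / l2\<^sup>2 = c2 t * (k2 * g2 t / l2\<^sup>2)" by simp
  ultimately have "(c1 t - c2 t) * (k1 * g1 t / l1\<^sup>2) = 0"
    by (simp add: algebra_simps)
  moreover have "k1 * g1 t / l1\<^sup>2 \<noteq> 0"
    using zero[OF t] k g1(1)[OF tI] g2(1)[OF tI] l unfolding curvature_of_def by auto
  ultimately show "c1 t = c2 t" by simp
qed

lemma normal_unique:
  assumes ab: "a < b" "{a..b} \<subseteq> I" and n: "normal_on {a..b} m1 m2" "normal_on {a..b} m1' m2'"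
    and not: "\<not> abnormal_on {a..b}"
  shows "m1 = m1'" "m2 = m2'"
proof -
  have "curvature_of (m1 - m1') (m2 - m2') t = 0" if t: "t \<in> {a..b}" for t
  proof -
    have "curvature_of m1 m2 t *\<^sub>R (\<i> * u t) = curvature_of m1' m2' t *\<^sub>R (\<i> * u t)"
      using n t unfolding normal_on_def by (intro vector_derivative_unique_Icc[OF ab(1) t, of u]) auto
    then have "curvature_of m1 m2 t = curvature_of m1' m2' t" using u(2)[of t] t ab(2) by auto
    then show ?thesis by (simp add: curvature_of_def left_diff_distrib diff_divide_distrib)
  qed
  from dependent_levers_imp_abnormal[OF ab _ this] not show "m1 = m1'" "m2 = m2'" by auto
qed

lemma normal_on_subset: "normal_on S m1 m2 \<Longrightarrow> T \<subseteq> S \<Longrightarrow> normal_on T m1 m2"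
  unfolding normal_on_def by (blast intro: has_vector_derivative_within_subset)

lemma curvature_deriv:
  "t \<in> I \<Longrightarrow> (curvature_of m1 m2 has_real_derivative
     c1 t * (m1 * g1 t / l1\<^sup>2) + c2 t * (m2 * g2 t / l2\<^sup>2)) (at t within I)"
  unfolding curvature_of_def[abs_def]
  by (rule DERIV_cong[OF DERIV_add[OF DERIV_cdivide[OF DERIV_cmult[OF g1(2)]] DERIV_cdivide[OF DERIV_cmult[OF g2(2)]]]])
    (auto simp: algebra_simps)

lemma normal_components_deriv:
  assumes "normal_on S m1 m2" "S \<subseteq> I" "t \<in> S"
  shows "(s1 has_real_derivative (curvature_of m1 m2 t - s1 t) * c1 t) (at t within S)"
    "(c1 has_real_derivative - (curvature_of m1 m2 t - s1 t) * s1 t) (at t within S)"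
    "(s2 has_real_derivative (curvature_of m1 m2 t - s2 t) * c2 t) (at t within S)"
    "(c2 has_real_derivative - (curvature_of m1 m2 t - s2 t) * s2 t) (at t within S)"
  using assms rates_deriv[OF _ assms(3) bicycling_subset[OF q(1) assms(2)]]
    rates_deriv[OF _ assms(3) bicycling_subset[OF q(2) assms(2)]] l
  unfolding normal_on_def by auto

text \<open>
  On a normal arc \<open>X = c1 - c2\<close> and \<open>Y = \<kappa> - s1 - s2\<close> satisfy a homogeneous linear system.  On an abnormal
  piece \<open>X\<close> vanishes, hence also \<open>X' = - (s1 - s2) Y\<close>, and \<open>Y\<close> vanishes because \<open>s1 \<noteq> s2\<close>.
  Uniqueness for the linear system gives \<open>X = 0\<close> on the whole arc.
\<close>

lemma abnormal_propagates:
  assumes ab: "{a..b} \<subseteq> I" and n: "normal_on {a..b} m1 m2"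
    and cd: "c < d" "{c..d} \<subseteq> {a..b}" "abnormal_on {c..d}"
  shows "abnormal_on {a..b}"
proof -
  let ?\<kappa> = "curvature_of m1 m2"
  let ?e2 = "\<lambda>t. m2 * g2 t / l2\<^sup>2"
  define X where "X t = c1 t - c2 t" for t
  define Y where "Y t = ?\<kappa> t - s1 t - s2 t" for t
  have dX: "(X has_real_derivative - ((s1 t - s2 t) * Y t)) (at t within {a..b})" if "t \<in> {a..b}" for t
    unfolding X_def
    by (rule DERIV_cong[OF DERIV_diff[OF normal_components_deriv(2,4)[OF n ab that]]])
      (simp add: Y_def algebra_simps)
  have dY: "(Y has_real_derivative - (c2 t * Y t) + (s1 t - ?e2 t) * X t) (at t within {a..b})"
    if t: "t \<in> {a..b}" for t
  proof -
    have k: "(?\<kappa> has_real_derivative c1 t * (m1 * g1 t / l1\<^sup>2) + c2 t * (m2 * g2 t / l2\<^sup>2)) (at t within {a..b})"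
      using DERIV_subset[OF curvature_deriv ab] t ab by blast
    have e1: "m1 * g1 t / l1\<^sup>2 = ?\<kappa> t - ?e2 t" by (simp add: curvature_of_def)
    show ?thesis
      unfolding Y_def
      by (rule DERIV_cong[OF DERIV_diff[OF DERIV_diff[OF k normal_components_deriv(1)[OF n ab t]]
              normal_components_deriv(3)[OF n ab t]]])
        (unfold e1, simp add: Y_def X_def algebra_simps)
  qed
  have "c \<in> {a..b}" using cd by auto
  have X0: "X t = 0" if "t \<in> {c..d}" for t using cd(3) that by (simp add: abnormal_on_def X_def)
  have Y0: "Y c = 0"
  proof -
    have c: "c \<in> {c..d}" using cd by simp
    have "(X has_real_derivative - ((s1 c - s2 c) * Y c)) (at c within {c..d})"
      by (rule DERIV_subset[OF dX cd(2)]) (use c cd in auto)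
    moreover have "(X has_real_derivative 0) (at c within {c..d})"
      by (rule has_field_derivative_transform_within[of "\<lambda>_. 0" _ _ _ 1]) (use c X0 in auto)
    ultimately have "- ((s1 c - s2 c) * Y c) = 0"
      by (rule real_derivative_unique_Icc[OF cd(1) c])
    then have "(s1 c - s2 c) * Y c = 0" by simp
    moreover have "s1 c \<noteq> s2 c"
      using turning_rates_differ[of c] X0[OF c] \<open>c \<in> {a..b}\<close> ab by (auto simp: X_def)
    ultimately show ?thesis by simp
  qed
  have bounded: "\<exists>B. \<forall>t\<in>{a..b}. \<bar>f t\<bar> \<le> B" if "continuous_on {a..b} f" for f :: "real \<Rightarrow> real"
    using compact_imp_bounded[OF compact_continuous_image[OF that compact_Icc]]
    unfolding bounded_iff by auto
  note co = continuous_on_subset[OF _ ab]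
  note cc = continuous_on_components[THEN co]
  have "continuous_on {a..b} (\<lambda>t. s1 t - ?e2 t)"
    using l by (intro continuous_intros cc) auto
  from bounded[OF this] obtain B3 where B3: "\<And>t. t \<in> {a..b} \<Longrightarrow> \<bar>s1 t - ?e2 t\<bar> \<le> B3" by blast
  have "continuous_on {a..b} (\<lambda>t. s1 t - s2 t)" by (intro continuous_intros cc)
  from bounded[OF this] obtain B1 where B1: "\<And>t. t \<in> {a..b} \<Longrightarrow> \<bar>s1 t - s2 t\<bar> \<le> B1" by blast
  from bounded[OF cc(6)] obtain B2 where B2: "\<And>t. t \<in> {a..b} \<Longrightarrow> \<bar>c2 t\<bar> \<le> B2" by blast
  have E: "(X t)\<^sup>2 + (Y t)\<^sup>2 = 0" if t: "t \<in> {a..b}" for t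
  proof (rule zero_by_gronwall[OF _ _ _ \<open>c \<in> {a..b}\<close> _ t])
    fix t assume t: "t \<in> {a..b}"
    let ?E' = "2 * X t * - ((s1 t - s2 t) * Y t) + 2 * Y t * (- (c2 t * Y t) + (s1 t - ?e2 t) * X t)"
    show "((\<lambda>t. (X t)\<^sup>2 + (Y t)\<^sup>2) has_real_derivative ?E') (at t within {a..b})"
      by (rule derivative_eq_intros dX[OF t] dY[OF t] refl)+ (simp add: algebra_simps)
    have xy: "2 * \<bar>X t * Y t\<bar> \<le> (X t)\<^sup>2 + (Y t)\<^sup>2"
      using sum_squares_bound[of "\<bar>X t\<bar>" "\<bar>Y t\<bar>"] by (simp add: abs_mult)
    have "?E' = - (s1 t - s2 t) * (2 * (X t * Y t)) + - (2 * c2 t) * (Y t)\<^sup>2 + (s1 t - ?e2 t) * (2 * (X t * Y t))"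
      by (simp add: algebra_simps power2_eq_square)
    also have "\<bar>\<dots>\<bar> \<le> \<bar>s1 t - s2 t\<bar> * (2 * \<bar>X t * Y t\<bar>) + 2 * \<bar>c2 t\<bar> * (Y t)\<^sup>2 + \<bar>s1 t - ?e2 t\<bar> * (2 * \<bar>X t * Y t\<bar>)"
      by (intro order_trans[OF abs_triangle_ineq] add_mono) (simp_all add: abs_mult abs_minus_commute)
    also have "\<dots> \<le> B1 * ((X t)\<^sup>2 + (Y t)\<^sup>2) + 2 * B2 * ((X t)\<^sup>2 + (Y t)\<^sup>2) + B3 * ((X t)\<^sup>2 + (Y t)\<^sup>2)"
      using B1[OF t] B2[OF t] B3[OF t] xy by (intro add_mono mult_mono) auto
    finally show "\<bar>?E'\<bar> \<le> (B1 + 2 * B2 + B3) * ((X t)\<^sup>2 + (Y t)\<^sup>2)" by (simp add: algebra_simps)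
  qed (use X0[of c] Y0 cd in auto)
  show ?thesis
    unfolding abnormal_on_def
  proof
    fix t assume "t \<in> {a..b}"
    from E[OF this] have "X t = 0" by (simp add: sum_power2_eq_zero_iff)
    then show "c1 t = c2 t" by (simp add: X_def)
  qed
qed

text \<open>
  The set of points near which the motion is abnormal is open and closed in \<open>I\<close>, by
  \<open>abnormal_propagates\<close>.  If it is empty, no arc is abnormal, so the normal multiplier near each point is unique
  and locally constant.
\<close>

lemma abnormal_or_normal:
  assumes loc: "\<And>t. t \<in> I \<Longrightarrow> \<exists>\<epsilon>>0. \<forall>a b. a < b \<longrightarrow> {a..b} \<subseteq> I \<longrightarrow> {a..b} \<subseteq> {t - \<epsilon><..<t + \<epsilon>} \<longrightarrow>
      abnormal_on {a..b} \<or> (\<exists>m1 m2. normal_on {a..b} m1 m2)"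
  shows "abnormal_on I \<or> (\<exists>m1 m2. normal_on I m1 m2)"
proof -
  have nbhd: "\<exists>a b e. a < b \<and> {a..b} \<subseteq> I \<and> t \<in> {a..b} \<and> e > 0 \<and> I \<inter> {t - e<..<t + e} \<subseteq> {a..b} \<and> {a..b} \<subseteq> {t - \<epsilon><..<t + \<epsilon>}"
    if "t \<in> I" "\<epsilon> > 0" for t \<epsilon>
  proof -
    obtain x y where "x \<in> I" "y \<in> I" "x < y" using I(2) by blast
    from interval_neighbourhood[OF I(1) this that] show ?thesis by metis
  qed
  have cover: "\<exists>a b e. a < b \<and> {a..b} \<subseteq> I \<and> t \<in> {a..b} \<and> e > 0 \<and> I \<inter> {t - e<..<t + e} \<subseteq> {a..b} \<and>
      (abnormal_on {a..b} \<or> (\<exists>m1 m2. normal_on {a..b} m1 m2))" if "t \<in> I" for t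
    using loc[OF that] nbhd[OF that] by metis
  have connected: "connected I" using I(1) is_interval_connected by blast
  define A where "A t \<longleftrightarrow> (\<exists>e>0. abnormal_on (I \<inter> {t - e<..<t + e}))" for t
  have inherit: "I \<inter> {r - (e - \<bar>r - t\<bar>)<..<r + (e - \<bar>r - t\<bar>)} \<subseteq> I \<inter> {t - e<..<t + e}" for r t e :: real
    by auto
  have A_const: "A s \<longleftrightarrow> A t" if st: "s \<in> I" "t \<in> I" for s t
  proof (rule connected_local_const[OF connected st], rule ballI)
    fix t assume t: "t \<in> I"
    obtain a b e where ab: "a < b" "{a..b} \<subseteq> I" "t \<in> {a..b}" "e > 0" "I \<inter> {t - e<..<t + e} \<subseteq> {a..b}"
      "abnormal_on {a..b} \<or> (\<exists>m1 m2. normal_on {a..b} m1 m2)" using cover[OF t] by blast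
    have "A r \<longleftrightarrow> abnormal_on {a..b}" if r: "r \<in> I" "\<bar>r - t\<bar> < e" for r
    proof
      assume "abnormal_on {a..b}"
      then have "abnormal_on (I \<inter> {r - (e - \<bar>r - t\<bar>)<..<r + (e - \<bar>r - t\<bar>)})"
        using ab(5) inherit[of r e t] unfolding abnormal_on_def by blast
      then show "A r" unfolding A_def using r by (intro exI[of _ "e - \<bar>r - t\<bar>"]) auto
    next
      assume "A r"
      then obtain e' where e': "e' > 0" "abnormal_on (I \<inter> {r - e'<..<r + e'})" unfolding A_def by blast
      obtain c d where cd: "c < d" "{c..d} \<subseteq> I" "{c..d} \<subseteq> {r - min e' (e - \<bar>r - t\<bar>)<..<r + min e' (e - \<bar>r - t\<bar>)}"
        using nbhd[OF r(1), of "min e' (e - \<bar>r - t\<bar>)"] e'(1) r(2) by auto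
      have "{c..d} \<subseteq> {r - e'<..<r + e'}" by (rule order_trans[OF cd(3)]) auto
      then have ac: "abnormal_on {c..d}" using e'(2) cd(2) unfolding abnormal_on_def by blast
      have "{c..d} \<subseteq> {r - (e - \<bar>r - t\<bar>)<..<r + (e - \<bar>r - t\<bar>)}" by (rule order_trans[OF cd(3)]) auto
      then have "{c..d} \<subseteq> {a..b}" using cd(2) inherit[of r e t] ab(5) by blast
      then show "abnormal_on {a..b}"
        using ab(6) abnormal_propagates[OF ab(2) _ cd(1) _ ac] by blast
    qed
    then have "\<forall>r\<in>I. dist r t < e \<longrightarrow> (A t \<longleftrightarrow> A r)" using t ab(4) by (auto simp: dist_real_def)
    then show "eventually (\<lambda>r. A t = A r) (at t within I)"
      unfolding eventually_at using ab(4) by blast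
  qed
  show ?thesis
  proof (cases "\<exists>t\<in>I. A t")
    case True
    then have "A t" if "t \<in> I" for t using A_const that by blast
    then have "abnormal_on I" unfolding A_def abnormal_on_def by fastforce
    then show ?thesis ..
  next
    case notA: False
    define N where "N t m \<longleftrightarrow> (\<exists>a b e. a < b \<and> {a..b} \<subseteq> I \<and> t \<in> {a..b} \<and> e > 0 \<and>
        I \<inter> {t - e<..<t + e} \<subseteq> {a..b} \<and> normal_on {a..b} (fst m) (snd m))" for t m
    have ex: "\<exists>m e. e > 0 \<and> (\<forall>r\<in>I. \<bar>r - t\<bar> < e \<longrightarrow> N r m)" if t: "t \<in> I" for t
    proof -
      obtain a b e where ab: "a < b" "{a..b} \<subseteq> I" "t \<in> {a..b}" "e > 0" "I \<inter> {t - e<..<t + e} \<subseteq> {a..b}"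
        "abnormal_on {a..b} \<or> (\<exists>m1 m2. normal_on {a..b} m1 m2)" using cover[OF t] by blast
      have "\<not> abnormal_on {a..b}"
      proof
        assume "abnormal_on {a..b}"
        then have "A t" using ab(4,5) unfolding A_def abnormal_on_def by blast
        then show False using notA t by blast
      qed
      then obtain m1 m2 where n: "normal_on {a..b} m1 m2" using ab(6) by blast
      have "N r (m1, m2)" if r: "r \<in> I" "\<bar>r - t\<bar> < e" for r
      proof -
        have "r \<in> I \<inter> {t - e<..<t + e}" using r by auto
        then have "r \<in> {a..b}" using ab(5) by blast
        moreover have "I \<inter> {r - (e - \<bar>r - t\<bar>)<..<r + (e - \<bar>r - t\<bar>)} \<subseteq> {a..b}"
          using ab(5) inherit[of r e t] by blast
        ultimately show ?thesis
          unfolding N_def using ab(1,2) n r(2)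
          by (intro exI[of _ a] exI[of _ b] exI[of _ "e - \<bar>r - t\<bar>"]) auto
      qed
      then show ?thesis using ab(4) by blast
    qed
    have uniq: "m = m'" if t: "t \<in> I" and N: "N t m" "N t m'" for t m m'
    proof -
      obtain a b e where ab: "e > 0" "I \<inter> {t - e<..<t + e} \<subseteq> {a..b}" "normal_on {a..b} (fst m) (snd m)"
        using N(1) unfolding N_def by blast
      obtain a' b' e' where ab': "e' > 0" "I \<inter> {t - e'<..<t + e'} \<subseteq> {a'..b'}" "normal_on {a'..b'} (fst m') (snd m')"
        using N(2) unfolding N_def by blast
      obtain c d f where cd: "c < d" "{c..d} \<subseteq> I" "f > 0" "I \<inter> {t - f<..<t + f} \<subseteq> {c..d}" "{c..d} \<subseteq> {t - min e e'<..<t + min e e'}"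
        using nbhd[OF t, of "min e e'"] ab(1) ab'(1) by auto
      have "\<not> abnormal_on {c..d}"
      proof
        assume "abnormal_on {c..d}"
        then have "A t" using cd(3,4) unfolding A_def abnormal_on_def by blast
        then show False using notA t by blast
      qed
      moreover have "{c..d} \<subseteq> {t - e<..<t + e}" by (rule order_trans[OF cd(5)]) auto
      moreover have "{c..d} \<subseteq> {t - e'<..<t + e'}" by (rule order_trans[OF cd(5)]) auto
      ultimately have na: "\<not> abnormal_on {c..d}" and
        "{c..d} \<subseteq> I \<inter> {t - e<..<t + e}" "{c..d} \<subseteq> I \<inter> {t - e'<..<t + e'}" using cd(2) by blast+
      then have "normal_on {c..d} (fst m) (snd m)" "normal_on {c..d} (fst m') (snd m')"
        using ab(2,3) ab'(2,3) normal_on_subset by (meson subset_trans)+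
      then show ?thesis using normal_unique[OF cd(1,2)] na by (auto intro: prod_eqI)
    qed
    define M where "M t = (THE m. N t m)" for t
    have M: "M t = m" if "t \<in> I" "N t m" for t m
      unfolding M_def using that uniq by blast
    have M_const: "M s = M t" if st: "s \<in> I" "t \<in> I" for s t
    proof (rule connected_local_const[OF connected st], rule ballI)
      fix t assume t: "t \<in> I"
      obtain m e where me: "e > 0" "\<forall>r\<in>I. \<bar>r - t\<bar> < e \<longrightarrow> N r m" using ex[OF t] by blast
      then have "M r = m" if "r \<in> I" "\<bar>r - t\<bar> < e" for r using M that by blast
      then have "\<forall>r\<in>I. dist r t < e \<longrightarrow> M t = M r" using t me(1) by (simp add: dist_real_def)
      then show "eventually (\<lambda>r. M t = M r) (at t within I)"
        unfolding eventually_at using me(1) by blast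
    qed
    obtain t0 where t0: "t0 \<in> I" using I(2) by blast
    have "normal_on I (fst (M t0)) (snd (M t0))"
      unfolding normal_on_def
    proof
      fix t assume t: "t \<in> I"
      obtain m e where me: "e > 0" "\<forall>r\<in>I. \<bar>r - t\<bar> < e \<longrightarrow> N r m" using ex[OF t] by blast
      then have "N t m" using t by auto
      moreover then have "m = M t0" using M[OF t] M_const[OF t t0] by simp
      ultimately obtain a b e where ab: "{a..b} \<subseteq> I" "t \<in> {a..b}" "e > 0"
        "I \<inter> {t - e<..<t + e} \<subseteq> {a..b}" "normal_on {a..b} (fst (M t0)) (snd (M t0))"
        unfolding N_def by blast
      show "(u has_vector_derivative curvature_of (fst (M t0)) (snd (M t0)) t *\<^sub>R (\<i> * u t)) (at t within I)"
        using ab(2,5) unfolding at_within_interval_neighbourhood[OF ab(1,3,4)] normal_on_def by blast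
    qed
    then show ?thesis by blast
  qed
qed

text \<open>
  Differentiating the multiplier relation also shows that a normal arc is twice differentiable, which
  is not assumed of a horizontal curve.
\<close>

lemma multiplier_imp_abnormal_or_normal:
  assumes ab: "a < b" "{a..b} \<subseteq> I"
    and n: "\<not> (n0 = 0 \<and> n1 = 0 \<and> n2 = 0 \<and> p = 0)"
    and eq: "\<And>t. t \<in> {a..b} \<Longrightarrow> n0 *\<^sub>R u t + p + (n1 * g1 t / l1) *\<^sub>R (\<i> * q1 t) + (n2 * g2 t / l2) *\<^sub>R (\<i> * q2 t) = 0"
  shows "abnormal_on {a..b} \<or> (\<exists>m1 m2. normal_on {a..b} m1 m2)"
proof -
  define V where "V t = n1 *\<^sub>R ((g1 t / l1) *\<^sub>R (\<i> * q1 t)) + n2 *\<^sub>R ((g2 t / l2) *\<^sub>R (\<i> * q2 t))" for t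
  have Veq: "n0 *\<^sub>R u t + p + V t = 0" if "t \<in> {a..b}" for t
    using eq[OF that] by (simp add: V_def add.assoc)
  have dV: "(V has_vector_derivative curvature_of n1 n2 t *\<^sub>R (\<i> * u t)) (at t within {a..b})" if t: "t \<in> {a..b}" for t
  proof -
    have tI: "t \<in> I" using ab t by blast
    have 1: "((\<lambda>t. (g1 t / l1) *\<^sub>R (\<i> * q1 t)) has_vector_derivative (g1 t / l1\<^sup>2) *\<^sub>R (\<i> * u t)) (at t within {a..b})"
      by (rule lever_deriv[OF _ t bicycling_subset[OF q(1) ab(2)] DERIV_subset[OF g1(2)[OF tI] ab(2)]]) (use l in simp)
    have 2: "((\<lambda>t. (g2 t / l2) *\<^sub>R (\<i> * q2 t)) has_vector_derivative (g2 t / l2\<^sup>2) *\<^sub>R (\<i> * u t)) (at t within {a..b})"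
      by (rule lever_deriv[OF _ t bicycling_subset[OF q(2) ab(2)] DERIV_subset[OF g2(2)[OF tI] ab(2)]]) (use l in simp)
    show ?thesis
      unfolding V_def
      by (rule has_vector_derivative_eq_rhs[OF has_vector_derivative_add
            [OF bounded_linear.has_vector_derivative[OF bounded_linear_scaleR_right 1]
              bounded_linear.has_vector_derivative[OF bounded_linear_scaleR_right 2]]])
        (simp add: curvature_of_def scaleR_left_distrib)
  qed
  show ?thesis
  proof (cases "n0 = 0")
    case True
    have "V t = - p" if "t \<in> {a..b}" for t using Veq[OF that] True by (simp add: eq_neg_iff_add_eq_0 add.commute)
    have zero: "curvature_of n1 n2 t = 0" if t: "t \<in> {a..b}" for t
    proof -
      have "(V has_vector_derivative 0) (at t within {a..b})"
        by (rule has_vector_derivative_transform[OF t _ has_vector_derivative_const[of "- p"]])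
          (use \<open>\<And>t. t \<in> {a..b} \<Longrightarrow> V t = - p\<close> in auto)
      then have "curvature_of n1 n2 t *\<^sub>R (\<i> * u t) = 0"
        by (rule vector_derivative_unique_Icc[OF ab(1) t dV[OF t]])
      then show ?thesis using u(2)[of t] t ab(2) by auto
    qed
    have "\<not> (n1 = 0 \<and> n2 = 0)"
      using n True Veq[of a] ab(1) by (auto simp: V_def)
    then show ?thesis using dependent_levers_imp_abnormal[OF ab _ zero] by blast
  next
    case False
    have ueq: "u t = (- (1 / n0)) *\<^sub>R (p + V t)" if "t \<in> {a..b}" for t
    proof -
      have "n0 *\<^sub>R u t = - (p + V t)" using Veq[OF that] by (metis add.assoc eq_neg_iff_add_eq_0)
      then have "(1 / n0) *\<^sub>R (n0 *\<^sub>R u t) = (1 / n0) *\<^sub>R - (p + V t)" by simp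
      then show ?thesis using False by (simp add: algebra_simps)
    qed
    have "normal_on {a..b} (- n1 / n0) (- n2 / n0)"
      unfolding normal_on_def
    proof
      fix t assume t: "t \<in> {a..b}"
      have "((\<lambda>t. (- (1 / n0)) *\<^sub>R (p + V t)) has_vector_derivative (- (1 / n0)) *\<^sub>R (0 + curvature_of n1 n2 t *\<^sub>R (\<i> * u t))) (at t within {a..b})"
        by (intro bounded_linear.has_vector_derivative[OF bounded_linear_scaleR_right]
            has_vector_derivative_add has_vector_derivative_const dV[OF t])
      then have "(u has_vector_derivative (- (1 / n0)) *\<^sub>R (0 + curvature_of n1 n2 t *\<^sub>R (\<i> * u t))) (at t within {a..b})"
        by (rule has_vector_derivative_transform[OF t _, rotated]) (use ueq in auto)
      moreover have "(- (1 / n0)) *\<^sub>R (0 + curvature_of n1 n2 t *\<^sub>R (\<i> * u t)) = curvature_of (- n1 / n0) (- n2 / n0) t *\<^sub>R (\<i> * u t)"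
      proof -
        have "curvature_of (- n1 / n0) (- n2 / n0) t = - (1 / n0) * curvature_of n1 n2 t"
          by (simp add: curvature_of_def algebra_simps)
        then show ?thesis by (simp only: add_0_left scaleR_scaleR)
      qed
      ultimately show "(u has_vector_derivative curvature_of (- n1 / n0) (- n2 / n0) t *\<^sub>R (\<i> * u t)) (at t within {a..b})"
        by (simp only:)
    qed
    then show ?thesis by blast
  qed
qed

end

section \<open>The soliton equation\<close>

definition soliton_residual :: "real \<Rightarrow> real \<Rightarrow> real \<Rightarrow> real \<Rightarrow> real \<Rightarrow> real \<Rightarrow> real" where
  "soliton_residual a b k k1 k2 k4 = a * E0 k + b * E2 k k2 + E4 k k1 k2 k4"

definition jet :: "real set \<Rightarrow> (real \<Rightarrow> real) \<Rightarrow> (real \<Rightarrow> real) \<Rightarrow> (real \<Rightarrow> real) \<Rightarrow> (real \<Rightarrow> real) \<Rightarrow> (real \<Rightarrow> real) \<Rightarrow> bool" where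
  "jet I k k1 k2 k3 k4 \<longleftrightarrow> (\<forall>s\<in>I. (k has_real_derivative k1 s) (at s within I) \<and>
               (k1 has_real_derivative k2 s) (at s within I) \<and>
               (k2 has_real_derivative k3 s) (at s within I) \<and>
               (k3 has_real_derivative k4 s) (at s within I))"

lemma two_solitonI:
  assumes "arclength_curvature I c k" "jet I k k1 k2 k3 k4"
    and "\<And>s. s \<in> I \<Longrightarrow> soliton_residual a b (k s) (k1 s) (k2 s) (k4 s) = 0"
  shows "two_soliton I c"
  using assms unfolding two_soliton_def jet_def soliton_residual_def by blast

text \<open>
  If \<open>x\<close> has curvature \<open>k\<close>, then \<open>2 s - k\<close> is the curvature of the far end of the doubled segment.  Its
  derivatives are expressed by those of \<open>d = k - s\<close>, using \<open>s' = d c\<close> and \<open>c' = - d s\<close>.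
\<close>

lemma jet_antipodal:
  assumes k: "jet I k k1 k2 k3 k4"
    and s: "\<And>t. t \<in> I \<Longrightarrow> (s has_real_derivative (k t - s t) * c t) (at t within I)"
    and c: "\<And>t. t \<in> I \<Longrightarrow> (c has_real_derivative - (k t - s t) * s t) (at t within I)"
  defines "d \<equiv> \<lambda>t. k t - s t"
  defines "d1 \<equiv> \<lambda>t. k1 t - d t * c t"
  defines "d2 \<equiv> \<lambda>t. k2 t - d1 t * c t + (d t)\<^sup>2 * s t"
  defines "d3 \<equiv> \<lambda>t. k3 t - d2 t * c t + 3 * d t * d1 t * s t + (d t) ^ 3 * c t"
  shows "jet I (\<lambda>t. 2 * s t - k t) (\<lambda>t. 2 * d t * c t - k1 t)
     (\<lambda>t. 2 * d1 t * c t - 2 * (d t)\<^sup>2 * s t - k2 t)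
     (\<lambda>t. 2 * d2 t * c t - 6 * d t * d1 t * s t - 2 * (d t) ^ 3 * c t - k3 t)
     (\<lambda>t. 2 * d3 t * c t - 8 * d t * d2 t * s t - 6 * (d1 t)\<^sup>2 * s t - 12 * (d t)\<^sup>2 * d1 t * c t
        + 2 * (d t) ^ 4 * s t - k4 t)"
  unfolding jet_def
proof (intro ballI)
  fix t assume t: "t \<in> I"
  have dk: "(k has_real_derivative k1 t) (at t within I)"
       "(k1 has_real_derivative k2 t) (at t within I)"
       "(k2 has_real_derivative k3 t) (at t within I)"
       "(k3 has_real_derivative k4 t) (at t within I)"
    using k t unfolding jet_def by auto
  have ds: "(s has_real_derivative d t * c t) (at t within I)" and dc: "(c has_real_derivative - d t * s t) (at t within I)"
    using s[OF t] c[OF t] by (simp_all add: d_def)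
  have d: "(d has_real_derivative d1 t) (at t within I)"
    unfolding d_def d1_def by (rule derivative_eq_intros dk ds[unfolded d_def] refl)+
  have d1: "(d1 has_real_derivative d2 t) (at t within I)"
    unfolding d1_def[abs_def] by (rule derivative_eq_intros dk d dc refl)+ (simp add: d2_def d1_def power2_eq_square algebra_simps)
  have d2: "(d2 has_real_derivative d3 t) (at t within I)"
    unfolding d2_def[abs_def]
    by (rule derivative_eq_intros dk d d1 dc ds refl)+ (simp add: d3_def power2_eq_square power3_eq_cube algebra_simps)
  show "((\<lambda>t. 2 * s t - k t) has_real_derivative 2 * d t * c t - k1 t) (at t within I) \<and>
     ((\<lambda>t. 2 * d t * c t - k1 t) has_real_derivative 2 * d1 t * c t - 2 * (d t)\<^sup>2 * s t - k2 t) (at t within I) \<and>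
     ((\<lambda>t. 2 * d1 t * c t - 2 * (d t)\<^sup>2 * s t - k2 t) has_real_derivative
        2 * d2 t * c t - 6 * d t * d1 t * s t - 2 * (d t) ^ 3 * c t - k3 t) (at t within I) \<and>
     ((\<lambda>t. 2 * d2 t * c t - 6 * d t * d1 t * s t - 2 * (d t) ^ 3 * c t - k3 t) has_real_derivative
       2 * d3 t * c t - 8 * d t * d2 t * s t - 6 * (d1 t)\<^sup>2 * s t - 12 * (d t)\<^sup>2 * d1 t * c t
        + 2 * (d t) ^ 4 * s t - k4 t) (at t within I)"
  proof (intro conjI)
    show "((\<lambda>t. 2 * s t - k t) has_real_derivative 2 * d t * c t - k1 t) (at t within I)"
      by (rule derivative_eq_intros dk ds refl)+ simp
    show "((\<lambda>t. 2 * d t * c t - k1 t) has_real_derivative 2 * d1 t * c t - 2 * (d t)\<^sup>2 * s t - k2 t) (at t within I)"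
      by (rule derivative_eq_intros dk d dc refl)+ (simp add: power2_eq_square algebra_simps)
    show "((\<lambda>t. 2 * d1 t * c t - 2 * (d t)\<^sup>2 * s t - k2 t) has_real_derivative
        2 * d2 t * c t - 6 * d t * d1 t * s t - 2 * (d t) ^ 3 * c t - k3 t) (at t within I)"
      by (rule derivative_eq_intros dk d d1 dc ds refl)+ (simp add: power2_eq_square power3_eq_cube algebra_simps)
    show "((\<lambda>t. 2 * d2 t * c t - 6 * d t * d1 t * s t - 2 * (d t) ^ 3 * c t - k3 t) has_real_derivative
       2 * d3 t * c t - 8 * d t * d2 t * s t - 6 * (d1 t)\<^sup>2 * s t - 12 * (d t)\<^sup>2 * d1 t * c t
        + 2 * (d t) ^ 4 * s t - k4 t) (at t within I)"
      by (rule derivative_eq_intros dk d d1 d2 dc ds refl)+ (simp add: power2_eq_square power3_eq_cube power4_eq_xxxx algebra_simps)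
  qed
qed

definition soliton_curvature :: "real set \<Rightarrow> (real \<Rightarrow> real) \<Rightarrow> bool" where
  "soliton_curvature I k \<longleftrightarrow> (\<exists>k1 k2 k3 k4 a b. jet I k k1 k2 k3 k4 \<and>
     (\<forall>t\<in>I. soliton_residual a b (k t) (k1 t) (k2 t) (k4 t) = 0))"

lemma soliton_curvatureI:
  assumes "jet I k k1 k2 k3 k4" "\<And>t. t \<in> I \<Longrightarrow> soliton_residual a b (k t) (k1 t) (k2 t) (k4 t) = 0"
  shows "soliton_curvature I k"
  using assms unfolding soliton_curvature_def by blast

lemma soliton_residual_scaled:
  "soliton_residual (A / 8) (B / 8) k k1 k2 k4 =
     (2 * A * k + B * (2 * k2 + k ^ 3) + 16 * k4 + 40 * k\<^sup>2 * k2 + 40 * k * k1\<^sup>2 + 6 * k ^ 5) / 16"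
  unfolding soliton_residual_def E0_def E2_def E4_def by (simp add: field_simps)

text \<open>
  The algebraic core of the normal case.  Here \<open>a1\<close> and \<open>a2\<close> stand for \<open>1 / l1\<^sup>2\<close> and \<open>1 / l2\<^sup>2\<close>; after
  expressing them by \<open>s1\<close>, \<open>c1\<close>, \<open>s2\<close>, \<open>c2\<close> the claims are identities between polynomials that are homogeneous of
  degree five in six variables.  The quantities \<open>A\<close> and \<open>B\<close> are the two constants of motion.  The
  denominators \<open>8\<close> are pulled out so that the remaining identities have integer coefficients.
\<close>

lemma normal_soliton_identities:
  fixes s1 c1 s2 c2 e1 e2 :: real
  defines "a1 \<equiv> s1\<^sup>2 + c1\<^sup>2" and "a2 \<equiv> s2\<^sup>2 + c2\<^sup>2"
  defines "k \<equiv> e1 + e2" and "k1 \<equiv> e1 * c1 + e2 * c2"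
  defines "S \<equiv> e1 * s1 + e2 * s2"
  defines "k2 \<equiv> e1 * a1 + e2 * a2 - k * S"
  defines "k3 \<equiv> e1 * c1 * (a1 - k\<^sup>2) + e2 * c2 * (a2 - k\<^sup>2) - k1 * S"
  defines "k4 \<equiv> e1 * (a1 - k * s1) * (a1 - k\<^sup>2) + e2 * (a2 - k * s2) * (a2 - k\<^sup>2) - 3 * k * k1\<^sup>2 - k2 * S"
  defines "B \<equiv> 2 * S - k\<^sup>2"
  defines "A \<equiv> 8 * (a1 * e1 * s1 + a2 * e2 * s2) - (8 * k * k2 - 4 * k1\<^sup>2 + 3 * k ^ 4 + 2 * B * k\<^sup>2)"
  defines "d \<equiv> k - s1"
  defines "d1 \<equiv> k1 - d * c1"
  defines "d2 \<equiv> k2 - d1 * c1 + d\<^sup>2 * s1"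
  defines "d3 \<equiv> k3 - d2 * c1 + 3 * d * d1 * s1 + d ^ 3 * c1"
  shows "soliton_residual ((A + 8 * a1 * a2 - 4 * (a1 + a2) * B) / 8) ((4 * B - 8 * (a1 + a2)) / 8) k k1 k2 k4 = 0"
   (is ?x)
  and "soliton_residual ((A + 8 * a1 * a2 - 4 * (a1 + a2) * B) / 8) ((4 * B - 8 * (a1 + a2)) / 8)
     (2 * s1 - k) (2 * d * c1 - k1) (2 * d1 * c1 - 2 * d\<^sup>2 * s1 - k2)
     (2 * d3 * c1 - 8 * d * d2 * s1 - 6 * d1\<^sup>2 * s1 - 12 * d\<^sup>2 * d1 * c1 + 2 * d ^ 4 * s1 - k4) = 0"
   (is ?y)
proof -
  have z: "x / 16 = 0" if "x = 0" for x :: real using that by simp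
  show ?x unfolding soliton_residual_scaled by (rule z) (unfold assms, algebra)
  show ?y unfolding soliton_residual_scaled by (rule z) (unfold assms, algebra)
qed

text \<open>
  In the abnormal case \<open>c = c1 = c2\<close> and \<open>k = s1 + s2\<close> satisfies \<open>k'' + k\<^sup>3 / 2 = (a1 + a2) k / 2\<close>, the
  equation of an elastica, which implies the soliton equation with \<open>b = 0\<close> and this \<open>a\<close>.
\<close>

lemma abnormal_soliton_identities:
  fixes s1 s2 c :: real
  defines "a1 \<equiv> s1\<^sup>2 + c\<^sup>2" and "a2 \<equiv> s2\<^sup>2 + c\<^sup>2"
  defines "k \<equiv> s1 + s2" and "p \<equiv> c\<^sup>2 - s1 * s2"
  defines "k1 \<equiv> c * k" and "k2 \<equiv> p * k" and "k3 \<equiv> c * k * (p - k\<^sup>2)"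
    and "k4 \<equiv> p * k * (p - k\<^sup>2) - 3 * c\<^sup>2 * k ^ 3"
  defines "d \<equiv> k - s1"
  defines "d1 \<equiv> k1 - d * c"
  defines "d2 \<equiv> k2 - d1 * c + d\<^sup>2 * s1"
  defines "d3 \<equiv> k3 - d2 * c + 3 * d * d1 * s1 + d ^ 3 * c"
  shows "soliton_residual (- (2 * (a1 + a2)\<^sup>2 + (a1 - a2)\<^sup>2) / 8) (0 / 8) k k1 k2 k4 = 0" (is ?x)
  and "soliton_residual (- (2 * (a1 + a2)\<^sup>2 + (a1 - a2)\<^sup>2) / 8) (0 / 8)
     (2 * s1 - k) (2 * d * c - k1) (2 * d1 * c - 2 * d\<^sup>2 * s1 - k2)
     (2 * d3 * c - 8 * d * d2 * s1 - 6 * d1\<^sup>2 * s1 - 12 * d\<^sup>2 * d1 * c + 2 * d ^ 4 * s1 - k4) = 0" (is ?y)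
proof -
  have z: "x / 16 = 0" if "x = 0" for x :: real using that by simp
  show ?x unfolding soliton_residual_scaled by (rule z) (unfold assms, algebra)
  show ?y unfolding soliton_residual_scaled by (rule z) (unfold assms, algebra)
qed

text \<open>
  \<open>A\<close> and \<open>B\<close> have derivative zero, so the coefficients in \<open>normal_soliton_identities\<close> are the same at all times.
\<close>

lemma normal_soliton_curvature:
  assumes I: "convex I"
    and s1: "\<And>t. t \<in> I \<Longrightarrow> (s1 has_real_derivative (e1 t + e2 t - s1 t) * c1 t) (at t within I)"
    and c1: "\<And>t. t \<in> I \<Longrightarrow> (c1 has_real_derivative - (e1 t + e2 t - s1 t) * s1 t) (at t within I)"
    and s2: "\<And>t. t \<in> I \<Longrightarrow> (s2 has_real_derivative (e1 t + e2 t - s2 t) * c2 t) (at t within I)"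
    and c2: "\<And>t. t \<in> I \<Longrightarrow> (c2 has_real_derivative - (e1 t + e2 t - s2 t) * s2 t) (at t within I)"
    and e1: "\<And>t. t \<in> I \<Longrightarrow> (e1 has_real_derivative c1 t * e1 t) (at t within I)"
    and e2: "\<And>t. t \<in> I \<Longrightarrow> (e2 has_real_derivative c2 t * e2 t) (at t within I)"
    and a1: "\<And>t. t \<in> I \<Longrightarrow> (s1 t)\<^sup>2 + (c1 t)\<^sup>2 = a1"
    and a2: "\<And>t. t \<in> I \<Longrightarrow> (s2 t)\<^sup>2 + (c2 t)\<^sup>2 = a2"
  shows "soliton_curvature I (\<lambda>t. e1 t + e2 t)"
    and "soliton_curvature I (\<lambda>t. 2 * s1 t - (e1 t + e2 t))"
proof -
  define k where "k t = e1 t + e2 t" for t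
  define k1 where "k1 t = e1 t * c1 t + e2 t * c2 t" for t
  define S where "S t = e1 t * s1 t + e2 t * s2 t" for t
  define k2 where "k2 t = e1 t * a1 + e2 t * a2 - k t * S t" for t
  define k3 where "k3 t = e1 t * c1 t * (a1 - (k t)\<^sup>2) + e2 t * c2 t * (a2 - (k t)\<^sup>2) - k1 t * S t" for t
  define k4 where "k4 t = e1 t * (a1 - k t * s1 t) * (a1 - (k t)\<^sup>2) + e2 t * (a2 - k t * s2 t) * (a2 - (k t)\<^sup>2)
     - 3 * k t * (k1 t)\<^sup>2 - k2 t * S t" for t
  define B where "B t = 2 * S t - (k t)\<^sup>2" for t
  define A where "A t = 8 * (a1 * e1 t * s1 t + a2 * e2 t * s2 t)
     - (8 * k t * k2 t - 4 * (k1 t)\<^sup>2 + 3 * (k t) ^ 4 + 2 * B t * (k t)\<^sup>2)" for t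
  note ds = s1[folded k_def] c1[folded k_def] s2[folded k_def] c2[folded k_def] e1 e2
  have dk: "(k has_real_derivative k1 t) (at t within I)" if t: "t \<in> I" for t
    unfolding k_def[abs_def] by (rule derivative_eq_intros ds t refl)+ (simp add: k1_def)
  have dS: "(S has_real_derivative k t * k1 t) (at t within I)" if t: "t \<in> I" for t
    unfolding S_def[abs_def] by (rule derivative_eq_intros ds t refl)+ (simp add: k1_def algebra_simps)
  have dk1: "(k1 has_real_derivative k2 t) (at t within I)" if t: "t \<in> I" for t
  proof -
    have "(k1 has_real_derivative e1 t * ((s1 t)\<^sup>2 + (c1 t)\<^sup>2) + e2 t * ((s2 t)\<^sup>2 + (c2 t)\<^sup>2) - k t * S t) (at t within I)"
      unfolding k1_def[abs_def]
      by (rule derivative_eq_intros ds t refl)+ (simp add: S_def algebra_simps power2_eq_square)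
    then show ?thesis by (simp add: k2_def a1[OF t] a2[OF t])
  qed
  have dk2: "(k2 has_real_derivative k3 t) (at t within I)" if t: "t \<in> I" for t
    unfolding k2_def[abs_def]
    by (rule derivative_eq_intros ds dk dS t refl)+ (simp add: k3_def k1_def algebra_simps power2_eq_square)
  have dk3: "(k3 has_real_derivative k4 t) (at t within I)" if t: "t \<in> I" for t
  proof -
    have "(k3 has_real_derivative e1 t * ((s1 t)\<^sup>2 + (c1 t)\<^sup>2 - k t * s1 t) * (a1 - (k t)\<^sup>2)
        + e2 t * ((s2 t)\<^sup>2 + (c2 t)\<^sup>2 - k t * s2 t) * (a2 - (k t)\<^sup>2) - 3 * k t * (k1 t)\<^sup>2 - k2 t * S t) (at t within I)"
      unfolding k3_def[abs_def]
      by (rule derivative_eq_intros ds dk dS dk1 t refl)+ (simp add: k1_def algebra_simps power2_eq_square)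
    then show ?thesis by (simp add: k4_def a1[OF t] a2[OF t])
  qed
  have "\<exists>C. \<forall>t\<in>I. B t = C"
  proof (rule has_field_derivative_zero_constant[OF I])
    show "(B has_real_derivative 0) (at t within I)" if t: "t \<in> I" for t
      unfolding B_def[abs_def] by (rule derivative_eq_intros dS dk t refl)+ simp
  qed
  then obtain B0 where B0: "\<And>t. t \<in> I \<Longrightarrow> B t = B0" by blast
  have dB: "(B has_real_derivative 0) (at t within I)" if t: "t \<in> I" for t
    unfolding B_def[abs_def] by (rule derivative_eq_intros dS dk t refl)+ simp
  have "\<exists>C. \<forall>t\<in>I. A t = C"
  proof (rule has_field_derivative_zero_constant[OF I])
    show "(A has_real_derivative 0) (at t within I)" if t: "t \<in> I" for t
      unfolding A_def[abs_def]
      by (rule derivative_eq_intros ds dk dk1 dk2 dB t refl)+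
        (simp add: k3_def B_def k1_def algebra_simps power2_eq_square power3_eq_cube)
  qed
  then obtain A0 where A0: "\<And>t. t \<in> I \<Longrightarrow> A t = A0" by blast
  have J: "jet I k k1 k2 k3 k4"
    unfolding jet_def using dk dk1 dk2 dk3 by blast
  note ids = normal_soliton_identities[where ?s1.0 = "s1 t" and ?c1.0 = "c1 t" and ?s2.0 = "s2 t"
      and ?c2.0 = "c2 t" and ?e1.0 = "e1 t" and ?e2.0 = "e2 t" for t,
      folded k_def, folded k1_def S_def]
  let ?a = "(A0 + 8 * a1 * a2 - 4 * (a1 + a2) * B0) / 8" and ?b = "(4 * B0 - 8 * (a1 + a2)) / 8"
  have "soliton_residual ?a ?b (k t) (k1 t) (k2 t) (k4 t) = 0" if t: "t \<in> I" for t
    using ids(1)[of t, unfolded a1[OF t] a2[OF t], folded k2_def B_def, folded k4_def A_def, unfolded A0[OF t] B0[OF t]] .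
  then show "soliton_curvature I (\<lambda>t. e1 t + e2 t)"
    unfolding soliton_curvature_def k_def[abs_def, symmetric] using J by blast
  note J' = jet_antipodal[OF J ds(1) ds(2)]
  show "soliton_curvature I (\<lambda>t. 2 * s1 t - (e1 t + e2 t))"
    unfolding k_def[symmetric]
  proof (rule soliton_curvatureI[OF J', where a = ?a and b = ?b], goal_cases)
    case (3 t)
    then show ?case
      using ids(2)[of t, unfolded a1[OF 3] a2[OF 3], folded k2_def B_def, folded k3_def k4_def A_def, unfolded A0[OF 3] B0[OF 3]]
      by blast
  qed
qed

lemma abnormal_soliton_curvature:
  assumes s1: "\<And>t. t \<in> I \<Longrightarrow> (s1 has_real_derivative s2 t * c t) (at t within I)"
    and s2: "\<And>t. t \<in> I \<Longrightarrow> (s2 has_real_derivative s1 t * c t) (at t within I)"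
    and c: "\<And>t. t \<in> I \<Longrightarrow> (c has_real_derivative - s2 t * s1 t) (at t within I)"
    and a1: "\<And>t. t \<in> I \<Longrightarrow> (s1 t)\<^sup>2 + (c t)\<^sup>2 = a1"
    and a2: "\<And>t. t \<in> I \<Longrightarrow> (s2 t)\<^sup>2 + (c t)\<^sup>2 = a2"
  shows "soliton_curvature I (\<lambda>t. s1 t + s2 t)"
    and "soliton_curvature I (\<lambda>t. 2 * s1 t - (s1 t + s2 t))"
proof -
  define k where "k t = s1 t + s2 t" for t
  define p where "p t = (c t)\<^sup>2 - s1 t * s2 t" for t
  define k1 where "k1 t = c t * k t" for t
  define k2 where "k2 t = p t * k t" for t
  define k3 where "k3 t = c t * k t * (p t - (k t)\<^sup>2)" for t
  define k4 where "k4 t = p t * k t * (p t - (k t)\<^sup>2) - 3 * (c t)\<^sup>2 * (k t) ^ 3" for t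
  have dk: "(k has_real_derivative k1 t) (at t within I)" if t: "t \<in> I" for t
    unfolding k_def[abs_def] by (rule derivative_eq_intros s1 s2 t refl)+ (simp add: k1_def k_def algebra_simps)
  have dp: "(p has_real_derivative - c t * (k t)\<^sup>2) (at t within I)" if t: "t \<in> I" for t
    unfolding p_def[abs_def] by (rule derivative_eq_intros s1 s2 c t refl)+ (simp add: k_def algebra_simps power2_eq_square)
  have dk1: "(k1 has_real_derivative k2 t) (at t within I)" if t: "t \<in> I" for t
    unfolding k1_def[abs_def] by (rule derivative_eq_intros c dk t refl)+ (simp add: k1_def k2_def p_def algebra_simps power2_eq_square)
  have dk2: "(k2 has_real_derivative k3 t) (at t within I)" if t: "t \<in> I" for t
    unfolding k2_def[abs_def] by (rule derivative_eq_intros dp dk t refl)+ (simp add: k1_def k3_def algebra_simps power2_eq_square)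
  have dk3: "(k3 has_real_derivative k4 t) (at t within I)" if t: "t \<in> I" for t
    unfolding k3_def[abs_def]
    by (rule derivative_eq_intros c dp dk t refl)+ (simp add: k1_def k4_def p_def algebra_simps power2_eq_square power3_eq_cube)
  have J: "jet I k k1 k2 k3 k4"
    unfolding jet_def using dk dk1 dk2 dk3 by blast
  note ids = abnormal_soliton_identities[where ?s1.0 = "s1 t" and ?s2.0 = "s2 t" and c = "c t" for t,
      folded k_def p_def, folded k1_def k2_def k3_def k4_def]
  let ?a = "- (2 * (a1 + a2)\<^sup>2 + (a1 - a2)\<^sup>2) / 8" and ?b = "0 / 8 :: real"
  have "soliton_residual ?a ?b (k t) (k1 t) (k2 t) (k4 t) = 0" if t: "t \<in> I" for t
    using ids(1)[of t, unfolded a1[OF t] a2[OF t]] .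
  then show "soliton_curvature I (\<lambda>t. s1 t + s2 t)"
    unfolding soliton_curvature_def k_def[abs_def, symmetric] using J by blast
  have d1: "(s1 has_real_derivative (k t - s1 t) * c t) (at t within I)" if "t \<in> I" for t
    using s1[OF that] by (simp add: k_def)
  have d2: "(c has_real_derivative - (k t - s1 t) * s1 t) (at t within I)" if "t \<in> I" for t
    using c[OF that] by (simp add: k_def)
  note J' = jet_antipodal[OF J d1 d2]
  show "soliton_curvature I (\<lambda>t. 2 * s1 t - (s1 t + s2 t))"
    unfolding k_def[symmetric]
  proof (rule soliton_curvatureI[OF J', where a = ?a and b = ?b], goal_cases)
    case (3 t)
    then show ?case using ids(2)[of t, unfolded a1[OF 3] a2[OF 3]] by blast
  qed
qed

section \<open>Curvature of the three trajectories\<close>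

lemma interval_has_neighbourhood:
  assumes "is_interval I" "\<exists>s\<in>I. \<exists>t\<in>I. s < t" "t \<in> I"
  obtains a b :: real where "a < b" "t \<in> {a..b}" "at t within I = at t within {a..b}"
proof -
  obtain x y where "x \<in> I" "y \<in> I" "x < y" using assms(2) by blast
  from interval_neighbourhood[OF assms(1) this assms(3) zero_less_one]
  show thesis using that at_within_interval_neighbourhood by metis
qed

lemma real_derivative_unique_interval:
  fixes f :: "real \<Rightarrow> real"
  assumes "is_interval I" "\<exists>s\<in>I. \<exists>t\<in>I. s < t" "t \<in> I"
    and "(f has_real_derivative d) (at t within I)" "(f has_real_derivative d') (at t within I)"
  shows "d = d'"
proof -
  obtain a b where ab: "a < b" "t \<in> {a..b}" and e: "at t within I = at t within {a..b}"
    by (rule interval_has_neighbourhood[OF assms(1-3)])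
  show ?thesis using real_derivative_unique_Icc[OF ab assms(4,5)[unfolded e]] .
qed

lemma vector_derivative_within_interval:
  fixes f :: "real \<Rightarrow> 'a::euclidean_space"
  assumes "is_interval I" "\<exists>s\<in>I. \<exists>t\<in>I. s < t" "t \<in> I"
    and "(f has_vector_derivative d) (at t within I)"
  shows "vector_derivative f (at t within I) = d"
proof -
  obtain a b where ab: "a < b" "t \<in> {a..b}" and e: "at t within I = at t within {a..b}"
    by (rule interval_has_neighbourhood[OF assms(1-3)])
  show ?thesis using vector_derivative_within_closed_interval[OF ab assms(4)[unfolded e]] unfolding e .
qed

lemma norm_square_deriv:
  fixes f :: "real \<Rightarrow> complex"
  assumes "(f has_vector_derivative f') (at t within S)"
  shows "((\<lambda>t. (Re (f t))\<^sup>2 + (Im (f t))\<^sup>2) has_real_derivative 2 * (Re (f t) * Re f' + Im (f t) * Im f'))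
    (at t within S)"
proof -
  have "((\<lambda>t. Re (f t)) has_real_derivative Re f') (at t within S)"
     "((\<lambda>t. Im (f t)) has_real_derivative Im f') (at t within S)"
    using bounded_linear.has_vector_derivative[OF bounded_linear_Re assms]
      bounded_linear.has_vector_derivative[OF bounded_linear_Im assms]
    by (simp_all add: has_real_derivative_iff_has_vector_derivative)
  from DERIV_add[OF DERIV_power[OF this(1), of 2] DERIV_power[OF this(2), of 2]]
  show ?thesis by (rule DERIV_cong) simp
qed

text \<open>
  Since \<open>q\<close> has constant norm, \<open>q'\<close> is orthogonal to \<open>q\<close>; the motion of the back end along the segment does
  not contribute to this normal component, which is therefore that of \<open>u / l\<close>.
\<close>

lemma horizontal_imp_bicycling:
  fixes x m :: "real \<Rightarrow> complex"
  assumes I: "is_interval I" "\<exists>s\<in>I. \<exists>t\<in>I. s < t" and l: "l > 0"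
    and x: "\<And>t. t \<in> I \<Longrightarrow> (x has_vector_derivative u t) (at t within I)"
    and m: "\<And>t. t \<in> I \<Longrightarrow> (m has_vector_derivative m' t) (at t within I)"
    and along: "\<And>t. t \<in> I \<Longrightarrow> \<exists>k::real. m' t = k *\<^sub>R (m t - x t)"
    and len: "\<And>t. t \<in> I \<Longrightarrow> dist (x t) (m t) = l"
  shows "bicycling l I u (\<lambda>t. (1 / l) *\<^sub>R (x t - m t))"
  unfolding bicycling_def
proof (intro ballI conjI)
  fix t assume t: "t \<in> I"
  define q where "q t = (1 / l) *\<^sub>R (x t - m t)" for t
  have nq: "norm (q t) = 1" if "t \<in> I" for t 
  proof -
    have "norm (x t - m t) = l" using len[OF that] by (simp add: dist_norm)
    then show ?thesis using l by (simp add: q_def)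
  qed
  show "norm ((1 / l) *\<^sub>R (x t - m t)) = 1" using nq[OF t] unfolding q_def .
  obtain k where k: "m' t = k *\<^sub>R (m t - x t)" using along[OF t] by blast
  define q' where "q' = (1 / l) *\<^sub>R (u t - m' t)"
  have dq: "(q has_vector_derivative q') (at t within I)"
    unfolding q_def q'_def
    by (intro bounded_linear.has_vector_derivative[OF bounded_linear_scaleR_right]
        has_vector_derivative_diff x m t)
  have "m t - x t = (- l) *\<^sub>R q t" using l by (simp add: q_def)
  then have q': "q' = (1 / l) *\<^sub>R u t + k *\<^sub>R q t" using l by (simp add: q'_def k scaleR_diff_right scaleR_add_right)
  have "((\<lambda>t. (Re (q t))\<^sup>2 + (Im (q t))\<^sup>2) has_real_derivative 2 * (Re (q t) * Re q' + Im (q t) * Im q')) (at t within I)"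
    by (rule norm_square_deriv[OF dq])
  moreover have "((\<lambda>t. (Re (q t))\<^sup>2 + (Im (q t))\<^sup>2) has_real_derivative 0) (at t within I)"
    by (rule has_field_derivative_transform_within[of "\<lambda>_. 1" _ _ _ 1])
      (use t nq in \<open>auto simp flip: cmod_power2\<close>)
  ultimately have orth: "2 * (Re (q t) * Re q' + Im (q t) * Im q') = 0"
    by (rule real_derivative_unique_interval[OF I t])
  have 1: "(Re (q t))\<^sup>2 + (Im (q t))\<^sup>2 = 1" using nq[OF t] by (simp flip: cmod_power2)
  have "Re (q t) * Re q' + Im (q t) * Im q' = Re (u t * cnj (q t)) / l + k * ((Re (q t))\<^sup>2 + (Im (q t))\<^sup>2)"
    unfolding q' by (simp add: algebra_simps power2_eq_square add_divide_distrib)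
  then have "k = - (Re (u t * cnj (q t)) / l)"
    using orth unfolding 1 mult_1_right by (metis add.commute eq_neg_iff_add_eq_0 mult_eq_0_iff zero_neq_numeral)
  then have kk: "k = - Re (u t * cnj (q t)) / l" by (simp only: minus_divide_left)
  have "(u t * cnj (q t)) * q t = u t * of_real ((Re (q t))\<^sup>2 + (Im (q t))\<^sup>2)"
    by (simp add: complex_eq_iff power2_eq_square algebra_simps)
  then have u: "u t = (u t * cnj (q t)) * q t" unfolding 1 by simp
  obtain z where z: "z = u t * cnj (q t)" by blast
  have "q' = (1 / l) *\<^sub>R (z * q t) + (- Re z / l) *\<^sub>R q t"
    unfolding q' kk z by (simp only: u[symmetric])
  also have "\<dots> = (Im z / l) *\<^sub>R (\<i> * q t)"
    using l by (simp add: complex_eq_iff field_simps)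
  finally have "q' = (Im (u t * cnj (q t)) / l) *\<^sub>R (\<i> * q t)" unfolding z .
  then show "((\<lambda>t. (1 / l) *\<^sub>R (x t - m t)) has_vector_derivative
      (Im (u t * cnj ((1 / l) *\<^sub>R (x t - m t))) / l) *\<^sub>R (\<i> * ((1 / l) *\<^sub>R (x t - m t)))) (at t within I)"
    using dq unfolding q_def[abs_def] by simp
qed

text \<open>
  The difference quotient of \<open>f\<close> is that of \<open>f\<^sup>2\<close> divided by \<open>f y + f x\<close>; continuity fixes the branch of the
  square root.
\<close>

lemma has_real_derivative_square_root:
  fixes f :: "real \<Rightarrow> real"
  assumes f: "continuous (at x within S) f" "f x \<noteq> 0"
    and sq: "((\<lambda>t. (f t)\<^sup>2) has_real_derivative D) (at x within S)"
  shows "(f has_real_derivative D / (2 * f x)) (at x within S)"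
  unfolding has_field_derivative_iff
proof (rule Lim_transform_eventually)
  have lim: "(f \<longlongrightarrow> f x) (at x within S)" using f(1) by (simp add: continuous_within)
  show "((\<lambda>y. ((f y)\<^sup>2 - (f x)\<^sup>2) / (y - x) / (f y + f x)) \<longlongrightarrow> D / (2 * f x)) (at x within S)"
    by (rule tendsto_divide) (use sq f(2) in \<open>auto simp: has_field_derivative_iff intro!: tendsto_eq_intros lim\<close>)
  have "eventually (\<lambda>y. f y + f x \<noteq> 0) (at x within S)"
    by (rule tendsto_imp_eventually_ne[OF tendsto_add[OF lim tendsto_const]]) (use f(2) in simp)
  then show "eventually (\<lambda>y. ((f y)\<^sup>2 - (f x)\<^sup>2) / (y - x) / (f y + f x) = (f y - f x) / (y - x)) (at x within S)"
    by eventually_elim (simp add: power2_eq_square square_diff_square_factored)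
qed

context linkage_motion
begin

text \<open>
  Here \<open>u\<close> is a priori only continuous.  But \<open>v = q1 / l1 - q2 / l2\<close> is differentiable and equals
  \<open>- \<delta> \<i> u\<close> with \<open>\<delta> = s1 - s2 \<noteq> 0\<close>.  So \<open>\<delta>\<^sup>2 = (norm v)\<^sup>2\<close> is differentiable, then \<open>\<delta>\<close> by continuity, and then
  \<open>u = \<i> v / \<delta>\<close>.
\<close>

lemma abnormal_deriv:
  assumes ab: "abnormal_on I" and t: "t \<in> I"
  shows "(u has_vector_derivative (s1 t + s2 t) *\<^sub>R (\<i> * u t)) (at t within I)"
proof -
  define \<delta> where "\<delta> t = s1 t - s2 t" for t
  define v where "v t = (1 / l1) *\<^sub>R q1 t - (1 / l2) *\<^sub>R q2 t" for t
  have c: "c1 t = c2 t" if "t \<in> I" for t using ab that by (simp add: abnormal_on_def)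
  have q1eq: "(1 / l1) *\<^sub>R q1 t = Complex (c2 t) (- s1 t) * u t" if "t \<in> I" for t
    using direction_eq[of l1 u t q1] l u(2)[OF that] c[OF that] by simp
  have q2eq: "(1 / l2) *\<^sub>R q2 t = Complex (c2 t) (- s2 t) * u t" if "t \<in> I" for t
    using direction_eq[of l2 u t q2] l u(2)[OF that] by simp
  have veq: "v t = (- \<delta> t) *\<^sub>R (\<i> * u t)" if "t \<in> I" for t
    unfolding v_def q1eq[OF that] q2eq[OF that] by (simp add: \<delta>_def complex_eq_iff algebra_simps)
  have \<delta>0: "\<delta> t \<noteq> 0" if "t \<in> I" for t using turning_rates_differ[OF that c[OF that]] by (simp add: \<delta>_def)
  define v' where "v' = \<delta> t *\<^sub>R (Complex (s1 t + s2 t) (c2 t) * u t)"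
  have dv: "(v has_vector_derivative v') (at t within I)"
  proof -
    have "(q1 has_vector_derivative s1 t *\<^sub>R (\<i> * q1 t)) (at t within I)"
      "(q2 has_vector_derivative s2 t *\<^sub>R (\<i> * q2 t)) (at t within I)"
      using q t unfolding bicycling_def turning_rate_def by blast+
    then have "(v has_vector_derivative (1 / l1) *\<^sub>R (s1 t *\<^sub>R (\<i> * q1 t)) - (1 / l2) *\<^sub>R (s2 t *\<^sub>R (\<i> * q2 t))) (at t within I)"
      unfolding v_def
      by (intro has_vector_derivative_diff bounded_linear.has_vector_derivative[OF bounded_linear_scaleR_right])
    moreover have "(1 / l1) *\<^sub>R (s1 t *\<^sub>R (\<i> * q1 t)) - (1 / l2) *\<^sub>R (s2 t *\<^sub>R (\<i> * q2 t))
       = s1 t *\<^sub>R (\<i> * ((1 / l1) *\<^sub>R q1 t)) - s2 t *\<^sub>R (\<i> * ((1 / l2) *\<^sub>R q2 t))" by simp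
    also have "\<dots> = v'"
      unfolding q1eq[OF t] q2eq[OF t] v'_def \<delta>_def by (simp add: complex_eq_iff algebra_simps)
    ultimately show ?thesis by simp
  qed
  have uu: "(Re (u t))\<^sup>2 + (Im (u t))\<^sup>2 = 1" if "t \<in> I" for t using u(2)[OF that] by (simp flip: cmod_power2)
  have sq: "(\<delta> t)\<^sup>2 = (Re (v t))\<^sup>2 + (Im (v t))\<^sup>2" if "t \<in> I" for t
  proof -
    have "(Re (v t))\<^sup>2 + (Im (v t))\<^sup>2 = (\<delta> t)\<^sup>2 * ((Re (u t))\<^sup>2 + (Im (u t))\<^sup>2)"
      unfolding veq[OF that] by (simp add: algebra_simps power2_eq_square)
    then show ?thesis using uu[OF that] by simp
  qed
  have "((\<lambda>t. (\<delta> t)\<^sup>2) has_real_derivative - 2 * c2 t * (\<delta> t)\<^sup>2) (at t within I)"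
  proof -
    have "((\<lambda>t. (Re (v t))\<^sup>2 + (Im (v t))\<^sup>2) has_real_derivative 2 * (Re (v t) * Re v' + Im (v t) * Im v')) (at t within I)"
      by (rule norm_square_deriv[OF dv])
    moreover have "2 * (Re (v t) * Re v' + Im (v t) * Im v') = - 2 * c2 t * (\<delta> t)\<^sup>2 * ((Re (u t))\<^sup>2 + (Im (u t))\<^sup>2)"
      unfolding veq[OF t] v'_def by (simp add: algebra_simps power2_eq_square)
    ultimately have "((\<lambda>t. (Re (v t))\<^sup>2 + (Im (v t))\<^sup>2) has_real_derivative - 2 * c2 t * (\<delta> t)\<^sup>2) (at t within I)"
      unfolding uu[OF t] by simp
    then show ?thesis
      by (rule has_field_derivative_transform_within[of _ _ _ _ 1]) (use t sq in auto)
  qed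
  moreover have "continuous (at t within I) \<delta>"
    using continuous_on_diff[OF continuous_on_components(3,4)] t
    unfolding \<delta>_def[abs_def] continuous_on_eq_continuous_within by blast
  ultimately have "(\<delta> has_real_derivative - 2 * c2 t * (\<delta> t)\<^sup>2 / (2 * \<delta> t)) (at t within I)"
    using has_real_derivative_square_root \<delta>0[OF t] by blast
  then have d\<delta>: "(\<delta> has_real_derivative - c2 t * \<delta> t) (at t within I)"
    using \<delta>0[OF t] by (simp add: power2_eq_square)
  have "((\<lambda>t. (1 / \<delta> t) *\<^sub>R (\<i> * v t)) has_vector_derivative
     (1 / \<delta> t) *\<^sub>R (\<i> * v') + (c2 t / \<delta> t) *\<^sub>R (\<i> * v t)) (at t within I)"
    by (rule has_vector_derivative_scaleR[OF _ has_vector_derivative_mult_right[OF dv]])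
      (use \<delta>0[OF t] in \<open>auto intro!: derivative_eq_intros d\<delta> simp: power2_eq_square\<close>)
  moreover have "(1 / \<delta> t) *\<^sub>R (\<i> * v') + (c2 t / \<delta> t) *\<^sub>R (\<i> * v t) = (s1 t + s2 t) *\<^sub>R (\<i> * u t)"
    unfolding veq[OF t] v'_def using \<delta>0[OF t] by (simp add: complex_eq_iff field_simps)
  moreover have "u t = (1 / \<delta> t) *\<^sub>R (\<i> * v t)" if "t \<in> I" for t
    unfolding veq[OF that] using \<delta>0[OF that] by (simp add: complex_eq_iff)
  ultimately show ?thesis
    using has_vector_derivative_transform[of t I u "\<lambda>t. (1 / \<delta> t) *\<^sub>R (\<i> * v t)"] t by simp
qed

lemma soliton_curvatures:
  assumes "abnormal_on I \<or> (\<exists>m1 m2. normal_on I m1 m2)"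
  obtains k where "\<And>t. t \<in> I \<Longrightarrow> (u has_vector_derivative k t *\<^sub>R (\<i> * u t)) (at t within I)"
    "soliton_curvature I k" "soliton_curvature I (\<lambda>t. 2 * s1 t - k t)" "soliton_curvature I (\<lambda>t. 2 * s2 t - k t)"
  using assms
proof
  assume ab: "abnormal_on I"
  have c: "c1 t = c2 t" if "t \<in> I" for t using ab that by (simp add: abnormal_on_def)
  note du = abnormal_deriv[OF ab]
  have d: "(s1 has_real_derivative s2 t * c2 t) (at t within I)"
    "(s2 has_real_derivative s1 t * c2 t) (at t within I)"
    "(c2 has_real_derivative - s1 t * s2 t) (at t within I)"
    "(c2 has_real_derivative - s2 t * s1 t) (at t within I)"
    if t: "t \<in> I" for t
    using rates_deriv[OF _ t q(1) du[OF t]] rates_deriv[OF _ t q(2) du[OF t]] l c[OF t]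
    by (auto simp: mult.commute)
  have n: "(s1 t)\<^sup>2 + (c2 t)\<^sup>2 = 1 / l1\<^sup>2" "(s2 t)\<^sup>2 + (c2 t)\<^sup>2 = 1 / l2\<^sup>2" if "t \<in> I" for t
    using component_norms[OF that] c[OF that] by simp_all
  show thesis
  proof (rule that[of "\<lambda>t. s1 t + s2 t"])
    show "soliton_curvature I (\<lambda>t. s1 t + s2 t)" "soliton_curvature I (\<lambda>t. 2 * s1 t - (s1 t + s2 t))"
      by (rule abnormal_soliton_curvature[OF d(1) d(2) d(4) n]; assumption)+
    show "soliton_curvature I (\<lambda>t. 2 * s2 t - (s1 t + s2 t))"
      using abnormal_soliton_curvature(2)[OF d(2) d(1) d(3) n(2) n(1)] by (simp add: add.commute)
  qed (rule du)
next
  assume "\<exists>m1 m2. normal_on I m1 m2"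
  then obtain m1 m2 where n: "normal_on I m1 m2" by blast
  define e1 where "e1 t = m1 * g1 t / l1\<^sup>2" for t
  define e2 where "e2 t = m2 * g2 t / l2\<^sup>2" for t
  have k: "curvature_of m1 m2 = (\<lambda>t. e1 t + e2 t)" by (simp add: curvature_of_def e1_def e2_def fun_eq_iff)
  note d = normal_components_deriv[OF n subset_refl, unfolded k]
  have de: "(e1 has_real_derivative c1 t * e1 t) (at t within I)" "(e2 has_real_derivative c2 t * e2 t) (at t within I)"
    if "t \<in> I" for t
    unfolding e1_def[abs_def] e2_def[abs_def]
    by (rule DERIV_cong[OF DERIV_cdivide[OF DERIV_cmult[OF g1(2)[OF that]]]], simp)
      (rule DERIV_cong[OF DERIV_cdivide[OF DERIV_cmult[OF g2(2)[OF that]]]], simp)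
  have "convex I" using I(1) by (simp add: is_interval_convex)
  note sc = normal_soliton_curvature[OF this d(1) d(2) d(3) d(4) de component_norms]
  have d': "(s2 has_real_derivative (e2 t + e1 t - s2 t) * c2 t) (at t within I)"
    "(c2 has_real_derivative - (e2 t + e1 t - s2 t) * s2 t) (at t within I)"
    "(s1 has_real_derivative (e2 t + e1 t - s1 t) * c1 t) (at t within I)"
    "(c1 has_real_derivative - (e2 t + e1 t - s1 t) * s1 t) (at t within I)" if "t \<in> I" for t
    using d[OF that] by (simp_all add: add.commute)
  show thesis
  proof (rule that[of "\<lambda>t. e1 t + e2 t"])
    show "(u has_vector_derivative (e1 t + e2 t) *\<^sub>R (\<i> * u t)) (at t within I)" if "t \<in> I" for t
      using n that unfolding normal_on_def k by blast
    show "soliton_curvature I (\<lambda>t. e1 t + e2 t)" "soliton_curvature I (\<lambda>t. 2 * s1 t - (e1 t + e2 t))"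
      by (rule sc; assumption)+
    show "soliton_curvature I (\<lambda>t. 2 * s2 t - (e1 t + e2 t))"
      using normal_soliton_curvature(2)[OF \<open>convex I\<close> d' de(2) de(1) component_norms(2) component_norms(1)]
      by (simp add: add.commute)
  qed
qed

end

lemma two_soliton_if_soliton_curvature:
  "arclength_curvature I c k \<Longrightarrow> soliton_curvature I k \<Longrightarrow> two_soliton I c"
  unfolding soliton_curvature_def using two_solitonI by blast

text \<open>
  The back end of the doubled segment has velocity \<open>q\<^sup>2 cnj u\<close>, the reflection of \<open>u\<close> in the line of the segment.
  Its direction angle is twice that of \<open>q\<close> minus that of \<open>u\<close>, whence the curvature.
\<close>

lemma arclength_curvature_antipodal:
  assumes l: "l \<noteq> 0" and q: "bicycling l I u q"
    and x: "\<And>t. t \<in> I \<Longrightarrow> (x has_vector_derivative u t) (at t within I)"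
    and u: "\<And>t. t \<in> I \<Longrightarrow> norm (u t) = 1"
      "\<And>t. t \<in> I \<Longrightarrow> (u has_vector_derivative k t *\<^sub>R (\<i> * u t)) (at t within I)"
  shows "arclength_curvature I (\<lambda>t. x t - (2 * l) *\<^sub>R q t) (\<lambda>t. 2 * turning_rate l u q t - k t)"
  unfolding arclength_curvature_def
proof (intro exI[of _ "\<lambda>t. (q t)\<^sup>2 * cnj (u t)"] ballI conjI)
  fix t assume t: "t \<in> I"
  have dq: "(q has_vector_derivative turning_rate l u q t *\<^sub>R (\<i> * q t)) (at t within I)" and nq: "norm (q t) = 1"
    using q t unfolding bicycling_def turning_rate_def by blast+
  obtain R M where RM: "R = rolling_rate l u q t" "M = turning_rate l u q t" by blast
  have ut: "u t = l *\<^sub>R (Complex R M * q t)" unfolding RM by (rule rates_complex[of l q t u, OF l nq])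
  have "((\<lambda>t. x t - (2 * l) *\<^sub>R q t) has_vector_derivative u t - (2 * l) *\<^sub>R (M *\<^sub>R (\<i> * q t))) (at t within I)"
    unfolding RM by (intro has_vector_derivative_diff x[OF t] dq bounded_linear.has_vector_derivative[OF bounded_linear_scaleR_right])
  moreover have "u t - (2 * l) *\<^sub>R (M *\<^sub>R (\<i> * q t)) = (q t)\<^sup>2 * cnj (u t)"
  proof -
    have 1: "q t * cnj (q t) = 1" using nq complex_norm_square[of "q t"] by simp
    have "(q t)\<^sup>2 * cnj (u t) = l *\<^sub>R (Complex R (- M) * q t * (q t * cnj (q t)))"
      unfolding ut by (simp add: power2_eq_square complex_cnj scaleR_conv_of_real algebra_simps)
    also have "\<dots> = u t - (2 * l) *\<^sub>R (M *\<^sub>R (\<i> * q t))"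
      unfolding ut 1 by (simp add: complex_eq_iff algebra_simps)
    finally show ?thesis ..
  qed
  ultimately show "((\<lambda>t. x t - (2 * l) *\<^sub>R q t) has_vector_derivative (q t)\<^sup>2 * cnj (u t)) (at t within I)" by simp
  show "norm ((q t)\<^sup>2 * cnj (u t)) = 1" using nq u(1)[OF t] by (simp add: norm_mult norm_power)
  have "((\<lambda>t. (q t * q t) * cnj (u t)) has_vector_derivative (2 * M - k t) *\<^sub>R (\<i> * ((q t * q t) * cnj (u t)))) (at t within I)"
    unfolding RM
    by (rule has_vector_derivative_eq_rhs[OF has_vector_derivative_mult[OF has_vector_derivative_mult[OF dq dq]
            has_vector_derivative_cnj[OF u(2)[OF t]]]])
      (simp add: scaleR_conv_of_real algebra_simps)
  then show "((\<lambda>t. (q t)\<^sup>2 * cnj (u t)) has_vector_derivative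
        (2 * turning_rate l u q t - k t) *\<^sub>R (\<i> * ((q t)\<^sup>2 * cnj (u t)))) (at t within I)"
    unfolding RM by (simp add: power2_eq_square)
qed

theorem theorem7:
  fixes l1 l2 :: real and I :: "real set" and \<gamma> :: "real \<Rightarrow> linkage"
  assumes "l1 > 0" and "l2 > 0" and "l1 \<noteq> l2"
    and "tricycling_geodesic l1 l2 I \<gamma>"
  shows "two_soliton I (pt_x \<circ> \<gamma>) \<and> two_soliton I (pt_y1 \<circ> \<gamma>) \<and> two_soliton I (pt_y2 \<circ> \<gamma>)"
proof -
  have l: "l1 > 0" "l2 > 0" "l1 \<noteq> l2" by fact+
  have I: "is_interval I" "\<exists>s\<in>I. \<exists>t\<in>I. s < t" and hor: "horizontal_curve l1 l2 I \<gamma>"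
    and unit: "\<And>t. t \<in> I \<Longrightarrow> norm (vector_derivative (pt_x \<circ> \<gamma>) (at t within I)) = 1"
    and min: "\<And>t. t \<in> I \<Longrightarrow> \<exists>\<epsilon>>0. \<forall>a\<in>I. \<forall>b\<in>I. t - \<epsilon> < a \<longrightarrow> a < b \<longrightarrow> b < t + \<epsilon> \<longrightarrow>
        length_minimizing l1 l2 a b \<gamma>"
    using assms(4) unfolding tricycling_geodesic_def by blast+
  define x where "x t = fst (\<gamma> t)" for t
  define m1 where "m1 t = fst (snd (\<gamma> t))" for t
  define m2 where "m2 t = snd (snd (\<gamma> t))" for t
  have \<gamma>: "\<gamma> t = (x t, m1 t, m2 t)" for t by (simp add: x_def m1_def m2_def)
  have link: "\<gamma> ` I \<subseteq> linkages l1 l2"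
    using hor unfolding horizontal_curve_def by (elim conjE)
  obtain \<gamma>' where \<gamma>'_cont: "continuous_on I \<gamma>'"
    and \<gamma>'_all: "\<forall>t\<in>I. (\<gamma> has_vector_derivative \<gamma>' t) (at t within I) \<and>
           (case (\<gamma> t, \<gamma>' t) of ((x, m1, m2), (x', m1', m2')) \<Rightarrow>
              (\<exists>k::real. m1' = k *\<^sub>R (m1 - x)) \<and>
              (\<exists>k::real. m2' = k *\<^sub>R (m2 - x)))"
    using hor unfolding horizontal_curve_def by (elim conjE exE) (rule that)
  have \<gamma>': "(\<gamma> has_vector_derivative \<gamma>' t) (at t within I)" if "t \<in> I" for t
    using bspec[OF \<gamma>'_all that] by (rule conjunct1)
  have along: "case (\<gamma> t, \<gamma>' t) of ((x, m1, m2), (x', m1', m2')) \<Rightarrow>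
              (\<exists>k::real. m1' = k *\<^sub>R (m1 - x)) \<and> (\<exists>k::real. m2' = k *\<^sub>R (m2 - x))" if "t \<in> I" for t
    using bspec[OF \<gamma>'_all that] by (rule conjunct2)
  define u where "u t = fst (\<gamma>' t)" for t
  define q1 where "q1 t = (1 / l1) *\<^sub>R (x t - m1 t)" for t
  define q2 where "q2 t = (1 / l2) *\<^sub>R (x t - m2 t)" for t
  have dx: "(x has_vector_derivative u t) (at t within I)" if "t \<in> I" for t
    unfolding x_def[abs_def] u_def by (rule bounded_linear.has_vector_derivative[OF bounded_linear_fst \<gamma>'[OF that]])
  have dm: "((\<lambda>t. snd (\<gamma> t)) has_vector_derivative snd (\<gamma>' t)) (at t within I)" if "t \<in> I" for t
    by (rule bounded_linear.has_vector_derivative[OF bounded_linear_snd \<gamma>'[OF that]])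
  have dm1: "(m1 has_vector_derivative fst (snd (\<gamma>' t))) (at t within I)"
    and dm2: "(m2 has_vector_derivative snd (snd (\<gamma>' t))) (at t within I)" if "t \<in> I" for t
    unfolding m1_def[abs_def] m2_def[abs_def]
    by (rule bounded_linear.has_vector_derivative[OF bounded_linear_fst dm[OF that]],
        rule bounded_linear.has_vector_derivative[OF bounded_linear_snd dm[OF that]])
  have pt_x: "pt_x \<circ> \<gamma> = x" by (simp add: fun_eq_iff pt_x_def \<gamma>)
  have cu: "continuous_on I u" unfolding u_def[abs_def] by (intro continuous_intros \<gamma>'_cont)
  have nu: "norm (u t) = 1" if "t \<in> I" for t
    using unit[OF that] vector_derivative_within_interval[OF I that dx[OF that]] unfolding pt_x by simp
  have len: "dist (x t) (m1 t) = l1" "dist (x t) (m2 t) = l2" if "t \<in> I" for t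
    using link that \<gamma>[of t] unfolding linkages_def by auto
  have al: "\<exists>k::real. fst (snd (\<gamma>' t)) = k *\<^sub>R (m1 t - x t)" "\<exists>k::real. snd (snd (\<gamma>' t)) = k *\<^sub>R (m2 t - x t)"
    if "t \<in> I" for t
    using along[OF that] unfolding \<gamma> by (auto split: prod.splits)
  have bq1: "bicycling l1 I u q1" unfolding q1_def[abs_def]
    by (rule horizontal_imp_bicycling[OF I l(1) dx dm1 al(1) len(1)])
  have bq2: "bicycling l2 I u q2" unfolding q2_def[abs_def]
    by (rule horizontal_imp_bicycling[OF I l(2) dx dm2 al(2) len(2)])
  have \<gamma>_eq: "\<gamma> = (\<lambda>t. linkage_at l1 l2 (x t) (q1 t) (q2 t))"
    using l by (simp add: fun_eq_iff \<gamma> linkage_at_def q1_def q2_def)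
  have cq: "continuous_on I q1" "continuous_on I q2"
    using bq1 bq2 unfolding bicycling_def by (intro continuous_on_vector_derivative; blast)+
  obtain s t where st: "s \<in> I" "t \<in> I" "s < t" using I(2) by blast
  have cd: "continuous_on I (rolling_rate l1 u q1)" "continuous_on I (rolling_rate l2 u q2)"
    unfolding rolling_rate_def[abs_def] divide_inverse by (intro continuous_intros cu cq)+
  obtain F1 where F1: "\<And>r. r \<in> I \<Longrightarrow> (F1 has_real_derivative rolling_rate l1 u q1 r) (at r within I)"
    using antiderivative_on_interval[OF I(1) st cd(1)] by blast
  obtain F2 where F2: "\<And>r. r \<in> I \<Longrightarrow> (F2 has_real_derivative rolling_rate l2 u q2 r) (at r within I)"
    using antiderivative_on_interval[OF I(1) st cd(2)] by blast
  let ?g1 = "\<lambda>t. exp (F1 t)" and ?g2 = "\<lambda>t. exp (F2 t)"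
  have dg1: "(?g1 has_real_derivative rolling_rate l1 u q1 t * ?g1 t) (at t within I)" if "t \<in> I" for t
    by (auto intro!: derivative_eq_intros F1[OF that])
  have dg2: "(?g2 has_real_derivative rolling_rate l2 u q2 t * ?g2 t) (at t within I)" if "t \<in> I" for t
    by (auto intro!: derivative_eq_intros F2[OF that])
  interpret linkage_motion l1 l2 I u q1 q2 ?g1 ?g2
    by unfold_locales (use l I cu nu bq1 bq2 dg1 dg2 in auto)
  have "abnormal_on I \<or> (\<exists>m1 m2. normal_on I m1 m2)"
  proof (rule abnormal_or_normal)
    fix t assume t: "t \<in> I"
    obtain \<epsilon> where \<epsilon>: "\<epsilon> > 0" "\<And>a b. a \<in> I \<Longrightarrow> b \<in> I \<Longrightarrow> t - \<epsilon> < a \<Longrightarrow> a < b \<Longrightarrow> b < t + \<epsilon> \<Longrightarrow>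
        length_minimizing l1 l2 a b \<gamma>" using min[OF t] by blast
    \<comment> \<open>arcs in this neighbourhood are shorter than \<open>l1 / 4\<close> and \<open>l2 / 4\<close>, as the multiplier rule requires\<close>
    let ?\<epsilon> = "min \<epsilon> (min (l1 / 8) (l2 / 8))"
    have "abnormal_on {a..b} \<or> (\<exists>m1 m2. normal_on {a..b} m1 m2)"
      if ab: "a < b" "{a..b} \<subseteq> I" "{a..b} \<subseteq> {t - ?\<epsilon><..<t + ?\<epsilon>}" for a b
    proof -
      have "a \<in> {a..b}" "b \<in> {a..b}" using ab(1) by auto
      then have aI: "a \<in> I" "b \<in> I" and ae: "a \<in> {t - ?\<epsilon><..<t + ?\<epsilon>}" "b \<in> {t - ?\<epsilon><..<t + ?\<epsilon>}"
        using ab(2,3) by blast+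
      have lm: "length_minimizing l1 l2 a b (\<lambda>t. linkage_at l1 l2 (x t) (q1 t) (q2 t))"
        using \<epsilon>(2)[OF aI] ae ab(1) unfolding \<gamma>_eq by auto
      have short: "b - a \<le> l1 / 4" "b - a \<le> l2 / 4" using ae by auto
      note sub = has_vector_derivative_within_subset[OF _ ab(2)] DERIV_subset[OF _ ab(2)]
      obtain n0 n1 n2 p where "\<not> (n0 = 0 \<and> n1 = 0 \<and> n2 = 0 \<and> p = 0)"
        "\<And>t. t \<in> {a..b} \<Longrightarrow> n0 *\<^sub>R u t + p + (n1 * ?g1 t / l1) *\<^sub>R (\<i> * q1 t) + (n2 * ?g2 t / l2) *\<^sub>R (\<i> * q2 t) = 0"
      proof (rule minimizing_imp_multiplier[OF l(1,2) ab(1) short continuous_on_subset[OF cu ab(2)] _ _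
            bicycling_subset[OF bq1 ab(2)] bicycling_subset[OF bq2 ab(2)] _ _ _ _ lm])
        fix t assume "t \<in> {a..b}"
        then have tI: "t \<in> I" using ab(2) by blast
        show "norm (u t) = 1" by (rule nu[OF tI])
        show "(x has_vector_derivative u t) (at t within {a..b})" by (rule sub(1)[OF dx[OF tI]])
        show "(?g1 has_real_derivative Re (u t * cnj (q1 t)) / l1 * ?g1 t) (at t within {a..b})"
          using sub(2)[OF dg1[OF tI]] unfolding rolling_rate_def .
        show "(?g2 has_real_derivative Re (u t * cnj (q2 t)) / l2 * ?g2 t) (at t within {a..b})"
          using sub(2)[OF dg2[OF tI]] unfolding rolling_rate_def .
      qed auto
      then show ?thesis by (rule multiplier_imp_abnormal_or_normal[OF ab(1,2)])
    qed
    moreover have "?\<epsilon> > 0" using \<epsilon>(1) l by simp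
    ultimately show "\<exists>\<epsilon>>0. \<forall>a b. a < b \<longrightarrow> {a..b} \<subseteq> I \<longrightarrow> {a..b} \<subseteq> {t - \<epsilon><..<t + \<epsilon>} \<longrightarrow>
      abnormal_on {a..b} \<or> (\<exists>m1 m2. normal_on {a..b} m1 m2)" by blast
  qed
  then obtain k where du: "\<And>t. t \<in> I \<Longrightarrow> (u has_vector_derivative k t *\<^sub>R (\<i> * u t)) (at t within I)"
    and sol: "soliton_curvature I k" "soliton_curvature I (\<lambda>t. 2 * turning_rate l1 u q1 t - k t)"
      "soliton_curvature I (\<lambda>t. 2 * turning_rate l2 u q2 t - k t)"
    by (rule soliton_curvatures) (rule that)
  have "arclength_curvature I x k"
    unfolding arclength_curvature_def using dx nu du by blast
  moreover have "arclength_curvature I (pt_y1 \<circ> \<gamma>) (\<lambda>t. 2 * turning_rate l1 u q1 t - k t)"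
  proof -
    have "pt_y1 \<circ> \<gamma> = (\<lambda>t. x t - (2 * l1) *\<^sub>R q1 t)"
      using l by (simp add: fun_eq_iff pt_y1_def \<gamma> q1_def scaleR_conv_of_real algebra_simps)
    then show ?thesis using arclength_curvature_antipodal[OF _ bq1 dx nu du] l by simp
  qed
  moreover have "arclength_curvature I (pt_y2 \<circ> \<gamma>) (\<lambda>t. 2 * turning_rate l2 u q2 t - k t)"
  proof -
    have "pt_y2 \<circ> \<gamma> = (\<lambda>t. x t - (2 * l2) *\<^sub>R q2 t)"
      using l by (simp add: fun_eq_iff pt_y2_def \<gamma> q2_def scaleR_conv_of_real algebra_simps)
    then show ?thesis using arclength_curvature_antipodal[OF _ bq2 dx nu du] l by simp
  qed
  ultimately show ?thesis
    using sol unfolding pt_x by (blast intro: two_soliton_if_soliton_curvature)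
qed

end
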